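(* There exists an algorithm that, given a finite list of axioms of a finitely axiomatizable canonical theory $T$ over a finite relational language, a description of an open interpretation $I\colon T_{\mathrm{Graph}}\leadsto T$ (i.e. the quantifier-free formula $I(E)(x,y)$), and $t\in\mathbb{N}$, computes the pair $(\chi(I),\pi^t_I)$ (where $\chi(I)$ may be $\infty$).
   Context: All languages are finite first-order relational languages; structures are finite and canonical (no predicate holds on a tuple with a repeated entry); theories are universal and canonical (they entail that each predicate fails on tuples with a repeated entry). $T_{\mathrm{Graph}}$ is the theory of simple graphs in language $\{E\}$. An open interpretation $I\colon T_{\mathrm{Graph}}\leadsto T$ assigns to $E$ a quantifier-free formula $I(E)(x,y)$ in the language of $T$ such that $T$ proves it symmetric and irreflexive; for a model $N$ of $T$, $I(N)$ is the graph on $V(N)$ whose edges are the pairs of distinct vertices satisfying $I(E)$. $\mathcal M_n[T]$ is the set of models of $T$ on $n$ vertices up to isomorphism. $K_t$ is the complete graph on $t$ vertices, $T_{n,\ell}$ the complete $\ell$-partite graph on $n$ vertices with parts of sizes $\lfloor n/\ell\rfloor$ or $\lceil n/\ell\rceil$; $G\subseteq H$ means an injection $V(G)\to V(H)$ mapping edges to edges; $p(K_t,G)$ is the fraction of $t$-subsets of $V(G)$ inducing a clique. $\pi^t_I=\lim_{n\to\infty}\sup_{N\in\mathcal M_n[T]}p(K_t,I(N))$ (with $\sup\varnothing=-\infty$), and $\chi(I)=\sup(\{\ell\in\mathbb{N}_+:\forall n\ \exists N\in\mathcal M_n[T],\ T_{n,\ell}\subseteq I(N)\}\cup\{0\})+1$.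 *)

theory Defs
  imports Complex_Main "HOL-Library.Extended_Real" "HOL-Library.Nat_Bijection"
begin

datatype recf = Z | S | Id nat | Cn recf "recf list" | Pr recf recf | Mn recf

inductive rec_eval :: "recf \<Rightarrow> nat list \<Rightarrow> nat \<Rightarrow> bool" where
  rz: "rec_eval Z xs 0"
| rs: "rec_eval S (x # xs) (Suc x)"
| rid: "i < length xs \<Longrightarrow> rec_eval (Id i) xs (xs ! i)"
| rcn: "list_all2 (\<lambda>g y. rec_eval g xs y) gs ys \<Longrightarrow> rec_eval f ys z \<Longrightarrow> rec_eval (Cn f gs) xs z"
| rpr0: "rec_eval f xs z \<Longrightarrow> rec_eval (Pr f g) (0 # xs) z"
| rprS: "rec_eval (Pr f g) (n # xs) y \<Longrightarrow> rec_eval g (n # y # xs) z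
          \<Longrightarrow> rec_eval (Pr f g) (Suc n # xs) z"
| rmn: "rec_eval f (n # xs) 0 \<Longrightarrow> (\<forall>m<n. \<exists>y. 0 < y \<and> rec_eval f (m # xs) y)
          \<Longrightarrow> rec_eval (Mn f) xs n"

text \<open>A language is a list of arities; predicate i has arity L!i.
  Variables are natural numbers.\<close>

datatype qf = Atom nat "nat list" | Eq nat nat | Neg qf | Conj qf qf | Disj qf qf | Tru

fun qf_vars :: "qf \<Rightarrow> nat set" where
  "qf_vars (Atom i vs) = set vs"
| "qf_vars (Eq a b) = {a, b}"
| "qf_vars (Neg p) = qf_vars p"
| "qf_vars (Conj p q) = qf_vars p \<union> qf_vars q"
| "qf_vars (Disj p q) = qf_vars p \<union> qf_vars q"
| "qf_vars Tru = {}"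

fun qf_wf :: "nat list \<Rightarrow> qf \<Rightarrow> bool" where
  "qf_wf L (Atom i vs) = (i < length L \<and> length vs = L ! i)"
| "qf_wf L (Eq a b) = True"
| "qf_wf L (Neg p) = qf_wf L p"
| "qf_wf L (Conj p q) = (qf_wf L p \<and> qf_wf L q)"
| "qf_wf L (Disj p q) = (qf_wf L p \<and> qf_wf L q)"
| "qf_wf L Tru = True"

definition is_struct :: "nat list \<Rightarrow> nat \<Rightarrow> (nat \<Rightarrow> nat list \<Rightarrow> bool) \<Rightarrow> bool" where
  "is_struct L n R \<longleftrightarrow>
     (\<forall>i xs. R i xs \<longrightarrow> i < length L \<and> length xs = L ! i \<and> set xs \<subseteq> {..<n})"

fun holds :: "(nat \<Rightarrow> nat list \<Rightarrow> bool) \<Rightarrow> (nat \<Rightarrow> nat) \<Rightarrow> qf \<Rightarrow> bool" where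
  "holds R \<sigma> (Atom i vs) = R i (map \<sigma> vs)"
| "holds R \<sigma> (Eq a b) = (\<sigma> a = \<sigma> b)"
| "holds R \<sigma> (Neg p) = (\<not> holds R \<sigma> p)"
| "holds R \<sigma> (Conj p q) = (holds R \<sigma> p \<and> holds R \<sigma> q)"
| "holds R \<sigma> (Disj p q) = (holds R \<sigma> p \<or> holds R \<sigma> q)"
| "holds R \<sigma> Tru = True"

text \<open>The axioms of a universal theory are given as quantifier-free formulas,
  read as their universal closures.\<close>

definition is_model :: "nat list \<Rightarrow> qf list \<Rightarrow> nat \<Rightarrow> (nat \<Rightarrow> nat list \<Rightarrow> bool) \<Rightarrow> bool" where
  "is_model L Ax n R \<longleftrightarrow> is_struct L n R \<and>
     (\<forall>\<sigma>. (\<forall>v. \<sigma> v < n) \<longrightarrow> (\<forall>ax\<in>set Ax. holds R \<sigma> ax))"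

definition canonical_theory :: "nat list \<Rightarrow> qf list \<Rightarrow> bool" where
  "canonical_theory L Ax \<longleftrightarrow>
     (\<forall>n R. is_model L Ax n R \<longrightarrow> (\<forall>i xs. R i xs \<longrightarrow> distinct xs))"

definition interp_edge :: "(nat \<Rightarrow> nat list \<Rightarrow> bool) \<Rightarrow> qf \<Rightarrow> nat \<Rightarrow> nat \<Rightarrow> bool" where
  "interp_edge R \<phi> x y = holds R (\<lambda>v. if v = 0 then x else y) \<phi>"

definition is_open_interp :: "nat list \<Rightarrow> qf list \<Rightarrow> qf \<Rightarrow> bool" where
  "is_open_interp L Ax \<phi> \<longleftrightarrow> qf_wf L \<phi> \<and> qf_vars \<phi> \<subseteq> {0, 1} \<and>
     (\<forall>n R. is_model L Ax n R \<longrightarrow>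
        (\<forall>x<n. \<forall>y<n. (interp_edge R \<phi> x y \<longleftrightarrow> interp_edge R \<phi> y x) \<and> \<not> interp_edge R \<phi> x x))"

definition igraph :: "(nat \<Rightarrow> nat list \<Rightarrow> bool) \<Rightarrow> qf \<Rightarrow> nat \<Rightarrow> nat \<Rightarrow> bool" where
  "igraph R \<phi> x y \<longleftrightarrow> x \<noteq> y \<and> interp_edge R \<phi> x y"

text \<open>Turan graph T_{n,l}: vertex i lies in part (i mod l); parts have sizes
  floor(n/l) or ceil(n/l).\<close>

definition turan :: "nat \<Rightarrow> nat \<Rightarrow> nat \<Rightarrow> nat \<Rightarrow> bool" where
  "turan n l x y \<longleftrightarrow> x < n \<and> y < n \<and> x mod l \<noteq> y mod l"

definition subgraph :: "nat \<Rightarrow> (nat \<Rightarrow> nat \<Rightarrow> bool) \<Rightarrow> nat \<Rightarrow> (nat \<Rightarrow> nat \<Rightarrow> bool) \<Rightarrow> bool" where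
  "subgraph n G m H \<longleftrightarrow> (\<exists>f. inj_on f {..<n} \<and> f ` {..<n} \<subseteq> {..<m} \<and>
     (\<forall>x<n. \<forall>y<n. G x y \<longrightarrow> H (f x) (f y)))"

definition clique_density :: "nat \<Rightarrow> nat \<Rightarrow> (nat \<Rightarrow> nat \<Rightarrow> bool) \<Rightarrow> real" where
  "clique_density t n G =
     real (card {A. A \<subseteq> {..<n} \<and> card A = t \<and> (\<forall>x\<in>A. \<forall>y\<in>A. x \<noteq> y \<longrightarrow> G x y)})
     / real (n choose t)"

text \<open>sup over the models of T on n vertices (Sup {} = -infinity in ereal).\<close>

definition pi_seq :: "nat list \<Rightarrow> qf list \<Rightarrow> qf \<Rightarrow> nat \<Rightarrow> nat \<Rightarrow> ereal" where
  "pi_seq L Ax \<phi> t n =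
     Sup {ereal (clique_density t n (igraph R \<phi>)) | R. is_model L Ax n R}"

definition chi :: "nat list \<Rightarrow> qf list \<Rightarrow> qf \<Rightarrow> enat" where
  "chi L Ax \<phi> = Sup ({enat l | l. 0 < l \<and>
       (\<forall>n. \<exists>R. is_model L Ax n R \<and> subgraph n (turan n l) n (igraph R \<phi>))} \<union> {0}) + 1"

fun enc_qf :: "qf \<Rightarrow> nat" where
  "enc_qf (Atom i vs) = prod_encode (0, prod_encode (i, list_encode vs))"
| "enc_qf (Eq a b) = prod_encode (1, prod_encode (a, b))"
| "enc_qf (Neg p) = prod_encode (2, enc_qf p)"
| "enc_qf (Conj p q) = prod_encode (3, prod_encode (enc_qf p, enc_qf q))"
| "enc_qf (Disj p q) = prod_encode (4, prod_encode (enc_qf p, enc_qf q))"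
| "enc_qf Tru = prod_encode (5, 0)"

definition enc_input :: "nat list \<Rightarrow> qf list \<Rightarrow> qf \<Rightarrow> nat \<Rightarrow> nat" where
  "enc_input L Ax \<phi> t =
     prod_encode (list_encode L, prod_encode (list_encode (map enc_qf Ax), prod_encode (enc_qf \<phi>, t)))"

definition decode_out :: "nat \<Rightarrow> enat \<times> ereal" where
  "decode_out c = (case prod_decode c of (a, b) \<Rightarrow>
     (if a = 0 then \<infinity> else enat (a - 1),
      (case prod_decode b of (s, r) \<Rightarrow>
         if s = 0 then - \<infinity> else
           (case prod_decode r of (p, q) \<Rightarrow> ereal (real p / real (Suc q))))))"

end

theory Submission
  imports Defs "HOL-Library.Ramsey" "HOL-Analysis.Convex"
begin

text \<open>
  The density \<open>pi\<close> is determined by \<open>chi\<close>: if \<open>chi = l + 1\<close> with \<open>l > 0\<close>, the Turan graphs \<open>T(n, l)\<close>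
  give the lower bound \<open>(1 - 0/l) * ... * (1 - (t - 1)/l)\<close>. For the upper bound, a sequence of models
  whose graphs omit some \<open>T(s, l + 1)\<close> has vanishing \<open>(l + 1)\<close>-clique density by Erdos's theorem on
  complete multipartite subhypergraphs, and the Moon--Moser inequalities, passed to a limit of the
  clique densities along a subsequence, propagate this down to the \<open>t\<close>-clique density.

  To compute \<open>chi\<close>, arrange the vertices in \<open>l\<close> parts and linearly ordered blocks. By Ramsey's theorem
  on sets of blocks, models containing all \<open>T(n, l)\<close> exist iff there is one on a bounded number
  of blocks in which the predicates depend only on the parts and on the order type of the blocks of a
  tuple; such a model can be blown up to any size. This is decidable for each \<open>l\<close>, and the same
  argument with a complete graph decides whether \<open>chi\<close> is infinite. If it is not, \<open>chi\<close> is found by an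
  unbounded search.
\<close>

section \<open>Computable functions on encoded data\<close>

text \<open>Finitely many \<open>(l + 1)\<close>-cliques, or a vanishing density of them, would
  leave an error term at each step of the downward propagation. In the limit that density is exactly
  0, so the induction is exact. The order on blocks cannot be dropped: if the theory is that of
  linear orders, no model with two vertices in one part has predicates that depend only on parts and
  equalities. An order-invariant structure is the most that Ramsey's theorem provides. The bound on
  the number of blocks comes from universality. An axiom looks at boundedly many vertices at a time,
  hence at boundedly many blocks, so a number of blocks that bounds both the variables of the axioms
  and the arities is enough to test all sizes at once. Infinite \<open>chi\<close> is a single
  realizability question, not a limit over \<open>l\<close>, because \<open>n\<close> vertices split
  into \<open>n + 1\<close> parts already form a complete graph. It has to be settled apart, since
  the search for the first failing number of parts would otherwise not halt. The value
  \<open>l = 0\<close> stands for theories without models of some size: there \<open>chi\<close> is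
  1 and the density is minus infinity.\<close>

class code =
  fixes enc :: "'a \<Rightarrow> nat"
  assumes inj_enc: "inj enc"

instantiation nat :: code
begin
definition "enc (n::nat) = n"
instance by standard (auto simp: enc_nat_def inj_def)
end

instantiation bool :: code
begin
definition "enc (b::bool) = (if b then 1 else 0)"
instance by standard (auto simp: enc_bool_def inj_def)
end

instantiation prod :: (code, code) code
begin
definition "enc (x::'a \<times> 'b) = prod_encode (enc (fst x), enc (snd x))"
instance by standard (auto simp: enc_prod_def inj_def prod_eq_iff dest: injD[OF inj_enc])
end

instantiation list :: (code) code
begin
definition "enc (xs::'a list) = list_encode (map enc xs)"
instance by standard (auto simp: enc_list_def inj_def list_encode_eq dest!: map_injective[OF _ inj_enc])
end

lemma enc_qf_inject: "enc_qf p = enc_qf q \<Longrightarrow> p = q"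
  by (induction p arbitrary: q; case_tac q) (auto simp: list_encode_eq)

instantiation qf :: code
begin
definition "enc (q::qf) = enc_qf q"
instance by standard (auto simp: enc_qf_def inj_def dest: enc_qf_inject)
end

lemma enc_eq_iff [simp]: "enc x = enc y \<longleftrightarrow> x = y"
  using inj_enc by (auto dest: injD)

lemma enc_pair: "enc (x, y) = prod_encode (enc x, enc y)"
  by (simp add: enc_prod_def)

lemma enc_Nil: "enc ([] :: 'a::code list) = 0"
  by (simp add: enc_list_def)

lemma enc_Cons: "enc (x # xs) = Suc (enc (x, xs))"
  by (simp add: enc_list_def enc_prod_def)

lemma enc_list_nat: "enc (xs :: nat list) = list_encode xs"
  by (simp add: enc_list_def enc_nat_def[abs_def])

lemma enc_input_eq: "enc (L, Ax, \<phi>, t) = enc_input L Ax \<phi> t"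
  by (simp add: enc_pair enc_input_def enc_list_nat)
     (simp add: enc_list_def enc_qf_def[abs_def] enc_nat_def enc_qf_def)

section \<open>Recursive programs for arithmetic and Cantor pairing\<close>

lemma rec_eval_Cn1: "rec_eval g xs y \<Longrightarrow> rec_eval f [y] z \<Longrightarrow> rec_eval (Cn f [g]) xs z"
  by (rule rec_eval.rcn) auto

lemma rec_eval_Cn2:
  "rec_eval g xs y \<Longrightarrow> rec_eval g' xs y' \<Longrightarrow> rec_eval f [y, y'] z \<Longrightarrow> rec_eval (Cn f [g, g']) xs z"
  by (rule rec_eval.rcn) auto

lemma rec_eval_Id0: "rec_eval (Id 0) (x # xs) x"
  and rec_eval_Id1: "rec_eval (Id 1) (x # y # xs) y"
  and rec_eval_Id2: "rec_eval (Id 2) (x # y # z # xs) z"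
  using rec_eval.rid[of 0 "x # xs"] rec_eval.rid[of 1 "x # y # xs"]
    rec_eval.rid[of 2 "x # y # z # xs"]
  by (auto simp: numeral_eq_Suc)

lemmas rec_eval_intros = rec_eval_Id0 rec_eval_Id1 rec_eval_Id2
  rec_eval.rz rec_eval.rs rec_eval_Cn1 rec_eval_Cn2

definition "r_add = Pr (Id 0) (Cn S [Id 1])"
definition "r_pred = Pr Z (Id 0)"
definition "r_sub = Pr (Id 0) (Cn r_pred [Id 1])"
definition "r_tri = Pr Z (Cn S [Cn r_add [Id 0, Id 1]])"
definition "r_pair = Cn r_add [Cn r_tri [r_add], Id 0]"
text \<open>Inverts Cantor pairing: the diagonal \<open>m + n\<close> of a code \<open>c\<close> is
  the least \<open>k\<close> with \<open>c < triangle (Suc k)\<close>. The subtrahend is the first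
  argument of \<open>r_sub\<close>, because \<open>Pr\<close> recurses on the first
  argument.\<close>

definition "r_root = Mn (Cn r_sub [Cn r_tri [Cn S [Id 0]], Cn S [Id 1]])"
definition "r_fst = Cn r_sub [Cn r_tri [r_root], Id 0]"
definition "r_snd = Cn r_sub [r_fst, r_root]"
definition "r_cond = Pr (Id 1) (Id 2)"

lemma rec_eval_add: "rec_eval r_add [m, n] (m + n)"
proof (induction m)
  case 0
  then show ?case unfolding r_add_def
    by (auto intro!: rec_eval.rpr0 rec_eval_intros)
next
  case (Suc m)
  have "rec_eval r_add [Suc m, n] (Suc (m + n))"
    unfolding r_add_def by (rule rec_eval.rprS[OF Suc[unfolded r_add_def]] rec_eval_intros)+
  then show ?case by simp
qed

lemma rec_eval_pred: "rec_eval r_pred [n] (n - 1)"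
  unfolding r_pred_def
  by (induction n) (auto intro!: rec_eval.rpr0 rec_eval_intros intro: rec_eval.rprS)

lemma rec_eval_sub: "rec_eval r_sub [m, n] (n - m)"
proof (induction m)
  case 0
  then show ?case unfolding r_sub_def
    by (auto intro!: rec_eval.rpr0 rec_eval_intros)
next
  case (Suc m)
  have "rec_eval r_sub [Suc m, n] ((n - m) - 1)"
    unfolding r_sub_def
    by (rule rec_eval.rprS[OF Suc[unfolded r_sub_def]] rec_eval_intros rec_eval_pred)+
  then show ?case by simp
qed

lemma rec_eval_tri: "rec_eval r_tri [n] (triangle n)"
proof (induction n)
  case 0
  then show ?case unfolding r_tri_def
    by (auto intro!: rec_eval.rpr0 rec_eval_intros)
next
  case (Suc n)
  have "rec_eval r_tri [Suc n] (Suc (n + triangle n))"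
    unfolding r_tri_def
    by (rule rec_eval.rprS[OF Suc[unfolded r_tri_def]] rec_eval_intros rec_eval_add)+
  then show ?case by (simp add: add.commute)
qed

lemma rec_eval_pair: "rec_eval r_pair [m, n] (prod_encode (m, n))"
  unfolding r_pair_def prod_encode_def split_conv
  by (rule rec_eval_intros rec_eval_add rec_eval_tri)+

lemma triangle_mono: "m \<le> n \<Longrightarrow> triangle m \<le> triangle n"
  by (rule lift_Suc_mono_le[of triangle]) auto

lemma rec_eval_root: "rec_eval r_root [prod_encode (m, n)] (m + n)"
  unfolding r_root_def
proof (rule rec_eval.rmn)
  let ?g = "Cn r_sub [Cn r_tri [Cn S [Id 0]], Cn S [Id 1]]"
  let ?c = "prod_encode (m, n)"
  have g: "rec_eval ?g [k, ?c] (Suc ?c - triangle (Suc k))" for k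
    by (rule rec_eval_intros rec_eval_sub rec_eval_tri)+
  show "rec_eval ?g [m + n, ?c] 0"
    using g[of "m + n"] by (simp add: prod_encode_def)
  show "\<forall>k<m + n. \<exists>y. 0 < y \<and> rec_eval ?g [k, ?c] y"
  proof (intro allI impI)
    fix k assume "k < m + n"
    then have "triangle (Suc k) \<le> triangle (m + n)" by (intro triangle_mono) auto
    then have "0 < Suc ?c - triangle (Suc k)" by (simp add: prod_encode_def)
    with g[of k] show "\<exists>y. 0 < y \<and> rec_eval ?g [k, ?c] y" by blast
  qed
qed

lemma rec_eval_fst: "rec_eval r_fst [prod_encode (m, n)] m"
proof -
  have "rec_eval r_fst [prod_encode (m, n)] (prod_encode (m, n) - triangle (m + n))"
    unfolding r_fst_def by (rule rec_eval_intros rec_eval_sub rec_eval_tri rec_eval_root)+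
  then show ?thesis by (simp add: prod_encode_def)
qed

lemma rec_eval_snd: "rec_eval r_snd [prod_encode (m, n)] n"
proof -
  have "rec_eval r_snd [prod_encode (m, n)] (m + n - m)"
    unfolding r_snd_def by (rule rec_eval_intros rec_eval_sub rec_eval_fst rec_eval_root)+
  then show ?thesis by simp
qed

lemma rec_eval_cond: "rec_eval r_cond [c, x, y] (if c = 0 then y else x)"
proof (induction c)
  case 0
  then show ?case unfolding r_cond_def
    by (auto intro!: rec_eval.rpr0 rec_eval_Id1[unfolded One_nat_def])
next
  case (Suc c)
  then show ?case unfolding r_cond_def
    by (auto intro!: rec_eval.rprS rec_eval_intros rec_eval_Id1[unfolded One_nat_def])
qed

text \<open>All functions are unary in an environment \<open>e\<close>. A function below a binder
  receives the pair of \<open>e\<close> and the bound value, as in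
  \<open>computable (\<lambda>p. f (fst p) (snd p))\<close>; computability of a term then follows
  from introduction rules along its syntax.\<close>

definition computable :: "('a::code \<Rightarrow> 'b::code) \<Rightarrow> bool" where
  "computable f \<longleftrightarrow> (\<exists>p. \<forall>x. rec_eval p [enc x] (enc (f x)))"

lemma computableI: "(\<And>x. rec_eval p [enc x] (enc (f x))) \<Longrightarrow> computable f"
  by (auto simp: computable_def)

lemma computableE:
  assumes "computable f"
  obtains p where "\<And>x. rec_eval p [enc x] (enc (f x))"
  using assms by (auto simp: computable_def)

lemma computable_id: "computable (\<lambda>e. e)"
  by (rule computableI[of "Id 0"]) (rule rec_eval_intros)

lemma computable_const: "computable (\<lambda>e. c)"
proof -
  have "\<exists>p. \<forall>x. rec_eval p [x] n" for n
  proof (induction n)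
    case 0
    then show ?case by (blast intro: rec_eval.rz)
  next
    case (Suc n)
    then obtain p where "\<And>x. rec_eval p [x] n" by blast
    then have "rec_eval (Cn S [p]) [x] (Suc n)" for x
      by (blast intro: rec_eval_intros)
    then show ?case by blast
  qed
  then show ?thesis unfolding computable_def by meson
qed

lemma computable_enc: "computable f \<Longrightarrow> computable (\<lambda>e. enc (f e))"
  by (simp add: computable_def enc_nat_def)

lemma computable_compose:
  assumes "computable f" and "computable g"
  shows "computable (\<lambda>e. f (g e))"
proof -
  obtain p q where "\<And>x. rec_eval p [enc x] (enc (f x))" "\<And>x. rec_eval q [enc x] (enc (g x))"
    using assms by (meson computableE)
  then show ?thesis by (intro computableI[of "Cn p [q]"]) (blast intro: rec_eval_Cn1)
qed

lemma computable_by_unary: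
  assumes "computable f" and "\<And>e. rec_eval r [enc (f e)] (enc (h e))"
  shows "computable h"
proof -
  obtain p where "\<And>x. rec_eval p [enc x] (enc (f x))"
    using assms by (meson computableE)
  with assms(2) show ?thesis by (intro computableI[of "Cn r [p]"]) (blast intro: rec_eval_Cn1)
qed

lemma computable_by_binary:
  assumes "computable f" "computable g"
    and "\<And>e. rec_eval r [enc (f e), enc (g e)] (enc (h e))"
  shows "computable h"
proof -
  obtain p q where "\<And>x. rec_eval p [enc x] (enc (f x))" "\<And>x. rec_eval q [enc x] (enc (g x))"
    using assms by (meson computableE)
  with assms(3) show ?thesis by (intro computableI[of "Cn r [p, q]"]) (blast intro: rec_eval_Cn2)
qed

lemma computable_Pair: "computable f \<Longrightarrow> computable g \<Longrightarrow> computable (\<lambda>e. (f e, g e))"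
  by (rule computable_by_binary[of f g r_pair]) (auto simp: enc_pair rec_eval_pair)

lemma computable_fst: "computable f \<Longrightarrow> computable (\<lambda>e. fst (f e))"
  by (rule computable_by_unary[of f r_fst]) (auto simp: enc_prod_def rec_eval_fst)

lemma computable_snd: "computable f \<Longrightarrow> computable (\<lambda>e. snd (f e))"
  by (rule computable_by_unary[of f r_snd]) (auto simp: enc_prod_def rec_eval_snd)

lemma computable_Suc: "computable f \<Longrightarrow> computable (\<lambda>e. Suc (f e))"
  by (rule computable_by_unary[of f S]) (auto simp: enc_nat_def rec_eval.rs)

lemma computable_add: "computable f \<Longrightarrow> computable g \<Longrightarrow> computable (\<lambda>e. f e + g e :: nat)"
  by (rule computable_by_binary[of f g r_add]) (auto simp: enc_nat_def rec_eval_add)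

lemma computable_diff: "computable f \<Longrightarrow> computable g \<Longrightarrow> computable (\<lambda>e. f e - g e :: nat)"
  by (rule computable_by_binary[of g f r_sub]) (auto simp: enc_nat_def rec_eval_sub)

lemma computable_if:
  assumes "computable b" "computable f" "computable g"
  shows "computable (\<lambda>e. if b e then f e else g e)"
proof -
  obtain p q r where "\<And>x. rec_eval p [enc x] (enc (b x))" "\<And>x. rec_eval q [enc x] (enc (f x))"
    "\<And>x. rec_eval r [enc x] (enc (g x))"
    using assms by (meson computableE)
  \<comment> \<open>Composition evaluates both branches, which is harmless because all functions
    here are total.\<close>
  then have "rec_eval (Cn r_cond [p, q, r]) [enc x] (enc (if b x then f x else g x))" for x
    using rec_eval_cond[of "enc (b x)" "enc (f x)" "enc (g x)"]
    by (intro rec_eval.rcn[of _ _ "[enc (b x), enc (f x), enc (g x)]"]) (auto simp: enc_bool_def split: if_splits)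
  then show ?thesis by (rule computableI)
qed

lemma computable_rec_nat:
  assumes "computable n" "computable f"
    and "computable (\<lambda>p. g (fst p) (fst (snd p)) (snd (snd p)))"
  shows "computable (\<lambda>e. rec_nat (f e) (\<lambda>k s. g e k s) (n e))"
proof -
  obtain p q r where p: "\<And>x. rec_eval p [enc x] (enc (n x))"
    and q: "\<And>x. rec_eval q [enc x] (enc (f x))"
    and r: "\<And>x. rec_eval r [enc x] (enc (g (fst x) (fst (snd x)) (snd (snd x))))"
    using assms by (meson computableE)
  \<comment> \<open>\<open>Pr\<close> hands its step function the list \<open>[k, s, e]\<close>,
    while \<open>r\<close> expects the single code of \<open>(e, k, s)\<close>.\<close>
  let ?r = "Cn r [Cn r_pair [Id 2, Cn r_pair [Id 0, Id 1]]]"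
  have step: "rec_eval ?r [k, enc s, enc e] (enc (g e k s))" for k s e
    using r[of "(e, k, s)"]
    by (auto simp: enc_pair enc_nat_def
        intro!: rec_eval_Cn1 rec_eval_Cn2 rec_eval_pair rec_eval_Id0 rec_eval_Id2 rec_eval_Id1[unfolded One_nat_def])
  have "rec_eval (Pr q ?r) [k, enc e] (enc (rec_nat (f e) (\<lambda>k s. g e k s) k))" for k e
  proof (induction k)
    case 0
    then show ?case using q by (auto intro: rec_eval.rpr0)
  next
    case (Suc k)
    from rec_eval.rprS[OF this step] show ?case by simp
  qed
  from computable_by_binary[OF assms(1) computable_id this[folded enc_nat_def]]
  show ?thesis by (simp add: enc_nat_def)
qed

lemma computable_funpow:
  fixes g :: "'a::code \<Rightarrow> 'b::code \<Rightarrow> 'b"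
  assumes "computable n" "computable f" "computable (\<lambda>p. g (fst p) (snd p))"
  shows "computable (\<lambda>e. ((\<lambda>s. g e s) ^^ n e) (f e))"
proof -
  have "(h ^^ k) s = rec_nat s (\<lambda>_. h) k" for h :: "'b \<Rightarrow> 'b" and k s
    by (induction k) auto
  moreover have "computable (\<lambda>p. g (fst p) (snd (snd p)))"
    using computable_compose[OF assms(3), of "\<lambda>p. (fst p, snd (snd p))"]
    by (simp add: computable_Pair computable_fst computable_snd computable_id)
  ultimately show ?thesis using computable_rec_nat[OF assms(1,2), of "\<lambda>e k s. g e s"] by simp
qed

lemma computable_Not:
  assumes "computable b"
  shows "computable (\<lambda>e. \<not> b e)"
proof -
  have "(\<lambda>e. \<not> b e) = (\<lambda>e. if b e then False else True)" by auto
  then show ?thesis using assms by (simp only: computable_if computable_const)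
qed

lemma computable_conj:
  assumes "computable b" "computable c"
  shows "computable (\<lambda>e. b e \<and> c e)"
proof -
  have "(\<lambda>e. b e \<and> c e) = (\<lambda>e. if b e then c e else False)" by auto
  then show ?thesis using assms by (simp only: computable_if computable_const)
qed

lemma computable_disj:
  assumes "computable b" "computable c"
  shows "computable (\<lambda>e. b e \<or> c e)"
proof -
  have "(\<lambda>e. b e \<or> c e) = (\<lambda>e. if b e then True else c e)" by auto
  then show ?thesis using assms by (simp only: computable_if computable_const)
qed

lemma computable_imp:
  assumes "computable b" "computable c"
  shows "computable (\<lambda>e. b e \<longrightarrow> c e)"
proof -
  have "(\<lambda>e. b e \<longrightarrow> c e) = (\<lambda>e. if b e then c e else True)" by auto
  then show ?thesis using assms by (simp only: computable_if computable_const)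
qed

lemma computable_is_zero:
  assumes "computable f"
  shows "computable (\<lambda>e. f e = (0::nat))"
proof -
  have "computable (\<lambda>e. rec_nat True (\<lambda>k s. False) (f e))"
    by (intro computable_rec_nat assms computable_const)
  moreover have "rec_nat True (\<lambda>k s. False) n \<longleftrightarrow> n = 0" for n
    by (cases n) auto
  ultimately show ?thesis by simp
qed

text \<open>As \<open>enc\<close> is injective, equality at any encoded type is equality of codes,
  and two numbers agree iff both truncated differences vanish.\<close>

lemma computable_eq:
  assumes "computable f" "computable g"
  shows "computable (\<lambda>e. f e = g e)"
proof -
  have "computable (\<lambda>e. (enc (f e) - enc (g e)) + (enc (g e) - enc (f e)) = 0)"
    by (intro computable_is_zero computable_add computable_diff computable_enc assms)
  moreover have "(enc x - enc y) + (enc y - enc x) = 0 \<longleftrightarrow> x = y" for x y :: 'b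
    by (metis enc_eq_iff add_is_0 diff_is_0_eq diff_self_eq_0 le_antisym)
  ultimately show ?thesis by simp
qed

lemma computable_less: "computable f \<Longrightarrow> computable g \<Longrightarrow> computable (\<lambda>e. f e < (g e :: nat))"
  using computable_Not[OF computable_is_zero[OF computable_diff], of g f] by (simp add: not_le)

lemmas computable_basic = computable_const computable_id computable_Pair computable_fst computable_snd
  computable_Suc computable_add computable_diff computable_if computable_Not computable_conj
  computable_disj computable_imp computable_eq computable_less

section \<open>List operations on codes\<close>

lemma computable_Cons: "computable f \<Longrightarrow> computable g \<Longrightarrow> computable (\<lambda>e. f e # g e)"
  by (rule computable_by_binary[of f g "Cn S [r_pair]"])
     (auto simp: enc_Cons enc_pair intro!: rec_eval_Cn1 rec_eval_pair rec_eval.rs)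

lemma computable_tl:
  assumes "computable f"
  shows "computable (\<lambda>e. tl (f e))"
proof (rule computable_by_unary[OF assms, of "Cn r_snd [r_pred]"])
  fix e
  \<comment> \<open>For the empty list the predecessor is 0, which is also the code of the pair
    \<open>(0, 0)\<close>; its second component 0 is again the code of the empty list.\<close>
  have "rec_eval r_snd [enc (f e) - 1] (enc (tl (f e)))"
    using rec_eval_snd[of 0 0] rec_eval_snd
    by (cases "f e") (auto simp: enc_Nil enc_Cons enc_pair prod_encode_def)
  then show "rec_eval (Cn r_snd [r_pred]) [enc (f e)] (enc (tl (f e)))"
    by (rule rec_eval_Cn1[OF rec_eval_pred])
qed

text \<open>The value \<open>hd []\<close> is unspecified but fixed, so the program may contain its
  code \<open>?d\<close> as a constant.\<close>

lemma computable_hd: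
  assumes "computable (f :: 'a::code \<Rightarrow> 'b::code list)"
  shows "computable (\<lambda>e. hd (f e))"
proof -
  let ?d = "enc (hd ([] :: 'b list))"
  define h where "h e = (if f e = [] then ?d else enc (hd (f e)))" for e
  define h' where "h' e = (case f e of [] \<Rightarrow> 0 | x # xs \<Rightarrow> enc x)" for e
  have "computable h'"
  proof (rule computable_by_unary[OF assms, of "Cn r_fst [r_pred]"])
    fix e
    have "rec_eval r_fst [enc (f e) - 1] (enc (h' e))"
      using rec_eval_fst[of 0 0] rec_eval_fst
      by (cases "f e") (auto simp: h'_def enc_Nil enc_Cons enc_pair prod_encode_def enc_nat_def)
    then show "rec_eval (Cn r_fst [r_pred]) [enc (f e)] (enc (h' e))"
      by (rule rec_eval_Cn1[OF rec_eval_pred])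
  qed
  then have "computable (\<lambda>e. if f e = [] then ?d else h' e)"
    by (intro computable_basic assms)
  moreover have "(if f e = [] then ?d else h' e) = enc (hd (f e))" for e
    by (cases "f e") (auto simp: h'_def)
  ultimately show ?thesis by (simp add: computable_def enc_nat_def)
qed

lemma length_le_list_encode: "length xs \<le> list_encode xs"
proof (induction xs)
  case (Cons x xs)
  then show ?case using le_prod_encode_2[of "list_encode xs" x] by simp
qed simp

lemma length_le_enc: "length xs \<le> enc xs"
  using length_le_list_encode[of "map enc xs"] by (simp add: enc_list_def)

text \<open>The loop runs \<open>enc xs\<close> times, which is at least \<open>length xs\<close>.\<close>

lemma computable_fold:
  assumes "computable xs" "computable a"
    and "computable (\<lambda>p. f (fst p) (fst (snd p)) (snd (snd p)))"
  shows "computable (\<lambda>e. fold (\<lambda>x s. f e x s) (xs e) (a e))"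
proof -
  define step where "step e p = (if fst p = [] then p else (tl (fst p), f e (hd (fst p)) (snd p)))" for e p
  have loop: "(step e ^^ n) (zs, s) = ([], fold (f e) zs s)" if "length zs \<le> n" for e n zs s
    using that
  proof (induction n arbitrary: zs s)
    case (Suc n)
    then show ?case
      by (cases zs) (auto simp: funpow_Suc_right step_def simp del: funpow.simps)
  qed simp
  have "computable (\<lambda>p. f (fst p) (hd (fst (snd p))) (snd (snd p)))"
    using computable_compose[OF assms(3), of "\<lambda>p. (fst p, hd (fst (snd p)), snd (snd p))"]
    by (simp add: computable_basic computable_hd)
  then have "computable (\<lambda>p. step (fst p) (snd p))"
    unfolding step_def by (intro computable_basic computable_tl)
  then have "computable (\<lambda>e. snd ((step e ^^ enc (xs e)) (xs e, a e)))"
    by (intro computable_snd computable_funpow computable_Pair computable_enc assms)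
  then show ?thesis by (simp add: loop length_le_enc)
qed

lemma computable_rev: "computable xs \<Longrightarrow> computable (\<lambda>e. rev (xs e))"
  using computable_fold[of xs "\<lambda>_. []" "\<lambda>e x s. x # s"]
  by (simp add: computable_basic computable_Cons fold_Cons_rev)

lemma computable_foldr:
  assumes "computable xs" "computable a"
    and "computable (\<lambda>p. f (fst p) (fst (snd p)) (snd (snd p)))"
  shows "computable (\<lambda>e. foldr (\<lambda>x s. f e x s) (xs e) (a e))"
  unfolding foldr_conv_fold by (intro computable_fold computable_rev assms)

lemma foldr_Cons_append: "foldr (\<lambda>x s. x # s) xs ys = xs @ ys"
  by (induction xs) auto

lemma computable_append: "computable xs \<Longrightarrow> computable ys \<Longrightarrow> computable (\<lambda>e. xs e @ ys e)"
  using computable_foldr[of xs ys "\<lambda>e x s. x # s"]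
  by (simp add: computable_basic computable_Cons foldr_Cons_append)

lemma computable_map:
  assumes "computable xs" "computable (\<lambda>p. f (fst p) (snd p))"
  shows "computable (\<lambda>e. map (\<lambda>x. f e x) (xs e))"
proof -
  have "computable (\<lambda>p. f (fst p) (fst (snd p)))"
    using computable_compose[OF assms(2), of "\<lambda>p. (fst p, fst (snd p))"]
    by (simp add: computable_basic)
  then have "computable (\<lambda>e. foldr (\<lambda>x s. f e x # s) (xs e) [])"
    by (intro computable_foldr computable_Cons computable_basic assms)
  moreover have "foldr (\<lambda>x s. h x # s) zs [] = map h zs" for h :: "'b \<Rightarrow> 'c" and zs
    by (induction zs) auto
  ultimately show ?thesis by simp
qed

lemma computable_concat:
  assumes "computable xss"
  shows "computable (\<lambda>e. concat (xss e))"
  unfolding concat_conv_foldr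
  by (intro computable_foldr computable_append computable_basic assms)

lemma computable_list_all:
  assumes "computable xs" "computable (\<lambda>p. f (fst p) (snd p))"
  shows "computable (\<lambda>e. \<forall>x\<in>set (xs e). f e x)"
proof -
  have "computable (\<lambda>p. f (fst p) (fst (snd p)))"
    using computable_compose[OF assms(2), of "\<lambda>p. (fst p, fst (snd p))"]
    by (simp add: computable_basic)
  then have "computable (\<lambda>e. foldr (\<lambda>x s. f e x \<and> s) (xs e) True)"
    by (intro computable_foldr computable_Cons computable_basic assms)
  moreover have "foldr (\<lambda>x s. h x \<and> s) zs True \<longleftrightarrow> (\<forall>x\<in>set zs. h x)" for h :: "'b \<Rightarrow> bool" and zs
    by (induction zs) auto
  ultimately show ?thesis by simp
qed

lemma computable_list_ex:
  assumes "computable xs" "computable (\<lambda>p. f (fst p) (snd p))"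
  shows "computable (\<lambda>e. \<exists>x\<in>set (xs e). f e x)"
proof -
  have "(\<lambda>e. \<exists>x\<in>set (xs e). f e x) = (\<lambda>e. \<not> (\<forall>x\<in>set (xs e). \<not> f e x))" by auto
  then show ?thesis using assms by (simp only: computable_list_all computable_Not)
qed

lemma computable_member:
  assumes "computable x" "computable xs"
  shows "computable (\<lambda>e. x e \<in> set (xs e))"
proof -
  have "computable (\<lambda>e. \<exists>y\<in>set (xs e). x e = y)"
    by (intro computable_list_ex assms computable_eq computable_compose[OF assms(1)] computable_basic)
  then show ?thesis by simp
qed

lemma fold_length_aux: "fold (\<lambda>x s. Suc s) xs n = length xs + n"
  by (induction xs arbitrary: n) auto

lemma computable_length: "computable xs \<Longrightarrow> computable (\<lambda>e. length (xs e))"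
  using computable_fold[of xs "\<lambda>_. 0" "\<lambda>e x s. Suc s"]
  by (simp add: computable_basic fold_length_aux)

lemma computable_mult:
  assumes "computable f" "computable g"
  shows "computable (\<lambda>e. f e * g e :: nat)"
proof -
  have "m * n = rec_nat 0 (\<lambda>_ s. s + n) m" for m n :: nat
    by (induction m) auto
  then show ?thesis
    by (simp only:) (intro computable_rec_nat assms computable_basic computable_compose[OF assms(2)])
qed

lemma computable_mod:
  assumes "computable f" "computable g"
  shows "computable (\<lambda>e. f e mod g e :: nat)"
proof -
  have "m mod n = rec_nat 0 (\<lambda>_ s. if Suc s = n then 0 else Suc s) m" for m n :: nat
    by (induction m) (auto simp: mod_Suc)
  then show ?thesis
    by (simp only:) (intro computable_rec_nat assms computable_basic computable_compose[OF assms(2)])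
qed

lemma computable_div:
  assumes "computable f" "computable g"
  shows "computable (\<lambda>e. f e div g e :: nat)"
proof -
  have "m div n = rec_nat 0 (\<lambda>k s. if Suc k mod n = 0 then Suc s else s) m" for m n :: nat
    by (induction m) (auto simp: div_Suc)
  then show ?thesis
    by (simp only:) (intro computable_rec_nat assms computable_basic computable_mod computable_compose[OF assms(2)])
qed

lemma computable_prod_lessThan:
  assumes "computable n" "computable (\<lambda>p. f (fst p) (snd p))"
  shows "computable (\<lambda>e. \<Prod>j<(n e :: nat). f e j :: nat)"
proof -
  have "(\<Prod>j<n. h j) = rec_nat 1 (\<lambda>k s. s * h k) n" for n and h :: "nat \<Rightarrow> nat"
    by (induction n) auto
  then show ?thesis
    by (simp only:) (intro computable_rec_nat assms computable_basic computable_mult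
      computable_compose[OF assms(2), of "\<lambda>p. (fst p, fst (snd p))", simplified])
qed

lemma computable_upt:
  assumes "computable n"
  shows "computable (\<lambda>e. [0..<n e])"
proof -
  have "[0..<n] = rec_nat [] (\<lambda>k s. s @ [k]) n" for n
    by (induction n) auto
  then show ?thesis
    by (simp only:) (intro computable_rec_nat assms computable_basic computable_append computable_Cons)
qed

lemma computable_drop:
  assumes "computable n" "computable xs"
  shows "computable (\<lambda>e. drop (n e) (xs e))"
proof -
  have "drop n xs = (tl ^^ n) xs" for n and xs :: "'b list"
    by (induction n) (auto simp: drop_Suc funpow_swap1 simp flip: tl_drop)
  then show ?thesis
    by (simp only:) (intro computable_funpow assms computable_basic computable_tl)
qed

lemma computable_n_lists:
  assumes "computable n" "computable xs"
  shows "computable (\<lambda>e. List.n_lists (n e) (xs e))"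
proof -
  have "List.n_lists n xs = rec_nat [[]] (\<lambda>_ s. concat (map (\<lambda>ys. map (\<lambda>y. y # ys) xs) s)) n"
    for n and xs :: "'b list"
    by (induction n) auto
  then show ?thesis
    by (simp only:) (intro computable_rec_nat assms computable_basic computable_concat computable_map
      computable_Cons computable_compose[OF assms(2)])
qed

lemma computable_subseqs:
  assumes "computable xs"
  shows "computable (\<lambda>e. subseqs (xs e))"
proof -
  have "subseqs xs = foldr (\<lambda>x s. map ((#) x) s @ s) xs [[]]" for xs :: "'b list"
    by (induction xs) (auto simp: Let_def)
  then show ?thesis
    by (simp only:) (intro computable_foldr assms computable_basic computable_append computable_map
      computable_Cons)
qed

text \<open>A number and the pair it decodes to have the same code, so the identity program suffices
  here and for the two lemmas that follow.\<close>

lemma computable_prod_decode: "computable f \<Longrightarrow> computable (\<lambda>e. prod_decode (f e))"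
  by (rule computable_by_unary[of f "Id 0"]) (auto simp: enc_prod_def enc_nat_def rec_eval_Id0)

lemma computable_prod_encode: "computable f \<Longrightarrow> computable (\<lambda>e. prod_encode (f e))"
  by (rule computable_by_unary[of f "Id 0"]) (auto simp: enc_prod_def enc_nat_def rec_eval_Id0)

lemma computable_list_decode: "computable f \<Longrightarrow> computable (\<lambda>e. list_decode (f e))"
  by (rule computable_by_unary[of f "Id 0"]) (auto simp: enc_list_nat enc_nat_def rec_eval_Id0)

lemmas computable_list = computable_Cons computable_tl computable_hd computable_fold computable_rev
  computable_append computable_map computable_concat computable_list_all computable_list_ex
  computable_member computable_length computable_upt computable_drop computable_n_lists
  computable_subseqs

lemmas computable_arith = computable_mult computable_mod computable_div computable_prod_lessThan
  computable_prod_decode computable_prod_encode computable_list_decode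

lemmas computable_intros = computable_basic computable_list computable_arith

section \<open>Evaluation of quantifier-free formulas\<close>

definition lookup :: "nat list \<Rightarrow> nat \<Rightarrow> nat" where
  "lookup \<sigma> v = hd (drop v \<sigma> @ [0])"

lemma computable_lookup: "computable \<sigma> \<Longrightarrow> computable v \<Longrightarrow> computable (\<lambda>e. lookup (\<sigma> e) (v e))"
  unfolding lookup_def by (intro computable_intros)

lemma lookup_nth: "v < length \<sigma> \<Longrightarrow> lookup \<sigma> v = \<sigma> ! v"
  by (simp add: lookup_def hd_append hd_drop_conv_nth)

text \<open>Truth of a formula is computed by course-of-values recursion on its code: \<open>tab\<close> lists the
  truth values of all smaller codes, the largest code first.\<close>

definition truth_step :: "(nat \<times> nat list) list \<Rightarrow> nat list \<Rightarrow> nat \<Rightarrow> bool list \<Rightarrow> bool" where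
  "truth_step rel \<sigma> c tab =
    (if fst (prod_decode c) = 0
     then (fst (prod_decode (snd (prod_decode c))),
           map (\<lambda>v. lookup \<sigma> v) (list_decode (snd (prod_decode (snd (prod_decode c)))))) \<in> set rel
     else if fst (prod_decode c) = 1
     then lookup \<sigma> (fst (prod_decode (snd (prod_decode c)))) = lookup \<sigma> (snd (prod_decode (snd (prod_decode c))))
     else if fst (prod_decode c) = 2
     then \<not> hd (drop (c - 1 - snd (prod_decode c)) tab)
     else if fst (prod_decode c) = 3
     then hd (drop (c - 1 - fst (prod_decode (snd (prod_decode c)))) tab) \<and>
          hd (drop (c - 1 - snd (prod_decode (snd (prod_decode c)))) tab)
     else if fst (prod_decode c) = 4
     then hd (drop (c - 1 - fst (prod_decode (snd (prod_decode c)))) tab) \<or>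
          hd (drop (c - 1 - snd (prod_decode (snd (prod_decode c)))) tab)
     else True)"

definition truth_table :: "(nat \<times> nat list) list \<Rightarrow> nat list \<Rightarrow> nat \<Rightarrow> bool list" where
  "truth_table rel \<sigma> n = rec_nat [] (\<lambda>k tab. truth_step rel \<sigma> k tab # tab) n"

lemma truth_table_nth:
  "k < n \<Longrightarrow> hd (drop (n - 1 - k) (truth_table rel \<sigma> n)) = truth_step rel \<sigma> k (truth_table rel \<sigma> k)"
proof (induction n)
  case (Suc n)
  have *: "truth_table rel \<sigma> (Suc n) = truth_step rel \<sigma> n (truth_table rel \<sigma> n) # truth_table rel \<sigma> n"
    by (simp add: truth_table_def)
  show ?case
  proof (cases "k = n")
    case False
    then have "Suc n - 1 - k = Suc (n - 1 - k)" using Suc.prems by auto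
    with Suc False show ?thesis by (simp add: *)
  qed (simp add: *)
qed simp

text \<open>The tags of \<open>Neg\<close>, \<open>Conj\<close> and \<open>Disj\<close> are
  positive, so by this bound a formula has a larger code than its immediate subformulas, as
  course-of-values recursion requires.\<close>

lemma sum_le_prod_encode: "m + n \<le> prod_encode (m, n)"
proof -
  have "k \<le> triangle k" for k by (induction k) auto
  from this[of "m + n"] show ?thesis by (simp add: prod_encode_def)
qed

lemma truth_step_enc_qf:
  "truth_step rel \<sigma> (enc_qf q) (truth_table rel \<sigma> (enc_qf q)) =
    holds (\<lambda>i xs. (i, xs) \<in> set rel) (lookup \<sigma>) q"
proof (induction q)
  case (Neg p)
  have "enc_qf p < enc_qf (Neg p)"
    using sum_le_prod_encode[of 2 "enc_qf p"] by simp
  with Neg show ?case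
    using truth_table_nth[of "enc_qf p" "enc_qf (Neg p)" rel \<sigma>]
    by (simp add: truth_step_def)
next
  case (Conj p q)
  have "enc_qf p < enc_qf (Conj p q)" "enc_qf q < enc_qf (Conj p q)"
    using sum_le_prod_encode[of 3 "prod_encode (enc_qf p, enc_qf q)"] sum_le_prod_encode[of "enc_qf p" "enc_qf q"]
    by auto
  with Conj show ?case
    using truth_table_nth[of "enc_qf p" "enc_qf (Conj p q)" rel \<sigma>]
      truth_table_nth[of "enc_qf q" "enc_qf (Conj p q)" rel \<sigma>]
    by (simp add: truth_step_def)
next
  case (Disj p q)
  have "enc_qf p < enc_qf (Disj p q)" "enc_qf q < enc_qf (Disj p q)"
    using sum_le_prod_encode[of 4 "prod_encode (enc_qf p, enc_qf q)"] sum_le_prod_encode[of "enc_qf p" "enc_qf q"]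
    by auto
  with Disj show ?case
    using truth_table_nth[of "enc_qf p" "enc_qf (Disj p q)" rel \<sigma>]
      truth_table_nth[of "enc_qf q" "enc_qf (Disj p q)" rel \<sigma>]
    by (simp add: truth_step_def)
qed (simp_all add: truth_step_def)

lemma computable_holds:
  assumes "computable rel" "computable \<sigma>" "computable q"
  shows "computable (\<lambda>e. holds (\<lambda>i xs. (i, xs) \<in> set (rel e)) (lookup (\<sigma> e)) (q e))"
proof -
  note cs = computable_compose[OF assms(1)] computable_compose[OF assms(2)] computable_compose[OF assms(3)]
  have *: "computable (\<lambda>e. enc (q e))" by (intro computable_enc assms)
  have "computable (\<lambda>p. truth_step (rel (fst p)) (\<sigma> (fst p)) (fst (snd p)) (snd (snd p)))"
    unfolding truth_step_def by (intro cs computable_intros computable_lookup)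
  then have "computable (\<lambda>e. truth_table (rel e) (\<sigma> e) (enc (q e)))"
    unfolding truth_table_def
    by (intro computable_rec_nat assms * computable_basic computable_Cons)
  then have "computable (\<lambda>e. (rel e, \<sigma> e, enc (q e), truth_table (rel e) (\<sigma> e) (enc (q e))))"
    by (intro computable_Pair assms *)
  moreover have "computable (\<lambda>p. truth_step (fst p) (fst (snd p)) (fst (snd (snd p))) (snd (snd (snd p))))"
    unfolding truth_step_def by (intro computable_intros computable_lookup)
  ultimately have "computable (\<lambda>e. truth_step (rel e) (\<sigma> e) (enc (q e)) (truth_table (rel e) (\<sigma> e) (enc (q e))))"
    by (drule_tac computable_compose) (assumption, simp)
  then show ?thesis by (simp add: enc_qf_def truth_step_enc_qf)
qed

section \<open>Clique densities\<close>

definition clique :: "(nat \<Rightarrow> nat \<Rightarrow> bool) \<Rightarrow> nat set \<Rightarrow> bool" where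
  "clique G A \<longleftrightarrow> (\<forall>x\<in>A. \<forall>y\<in>A. x \<noteq> y \<longrightarrow> G x y)"

definition cliques :: "nat \<Rightarrow> (nat \<Rightarrow> nat \<Rightarrow> bool) \<Rightarrow> nat \<Rightarrow> nat set set" where
  "cliques n G r = {A. A \<subseteq> {..<n} \<and> card A = r \<and> clique G A}"

definition extensions :: "nat \<Rightarrow> (nat \<Rightarrow> nat \<Rightarrow> bool) \<Rightarrow> nat set \<Rightarrow> nat set" where
  "extensions n G B = {v. v < n \<and> v \<notin> B \<and> clique G (insert v B)}"

lemma clique_density_eq: "clique_density t n G = real (card (cliques n G t)) / real (n choose t)"
  by (simp add: clique_density_def cliques_def clique_def)

lemma finite_cliques [simp]: "finite (cliques n G r)"
  by (rule finite_subset[of _ "Pow {..<n}"]) (auto simp: cliques_def)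

lemma finite_extensions [simp]: "finite (extensions n G B)"
  by (simp add: extensions_def)

lemma card_extensions_le: "card (extensions n G B) \<le> n"
  using card_mono[of "{..<n}" "extensions n G B"] by (auto simp: extensions_def)

lemma clique_mono: "clique G A \<Longrightarrow> B \<subseteq> A \<Longrightarrow> clique G B"
  by (auto simp: clique_def)

lemma cliquesD: "A \<in> cliques n G r \<Longrightarrow> finite A \<and> A \<subseteq> {..<n} \<and> card A = r \<and> clique G A"
  by (auto simp: cliques_def intro: finite_subset)

text \<open>Double counting: a clique with a marked vertex is the same as a smaller clique with an
  extending vertex. It is used for the constant function and for \<open>f\<close> the number of
  extensions.\<close>

lemma sum_cliques_delete:
  fixes f :: "nat set \<Rightarrow> nat"
  shows "(\<Sum>A\<in>cliques n G (Suc r). \<Sum>v\<in>A. f (A - {v})) = (\<Sum>B\<in>cliques n G r. card (extensions n G B) * f B)"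
proof -
  have "(\<Sum>A\<in>cliques n G (Suc r). \<Sum>v\<in>A. f (A - {v})) =
      (\<Sum>(A, v)\<in>Sigma (cliques n G (Suc r)) (\<lambda>A. A). f (A - {v}))"
    by (rule sum.Sigma) (auto dest: cliquesD)
  also have "\<dots> = (\<Sum>(B, v)\<in>Sigma (cliques n G r) (extensions n G). f B)"
  proof (rule sum.reindex_bij_witness[where i = "\<lambda>(B, v). (insert v B, v)" and j = "\<lambda>(A, v). (A - {v}, v)"])
    fix p assume "p \<in> Sigma (cliques n G (Suc r)) (\<lambda>A. A)"
    then obtain A v where p: "p = (A, v)" "A \<in> cliques n G (Suc r)" "v \<in> A" by auto
    then have "finite A" by (auto dest: cliquesD)
    then show "(case p of (A, v) \<Rightarrow> (A - {v}, v)) \<in> Sigma (cliques n G r) (extensions n G)"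
      using p by (auto simp: cliques_def extensions_def insert_absorb intro: clique_mono)
    show "(case case p of (A, v) \<Rightarrow> (A - {v}, v) of (B, v) \<Rightarrow> (insert v B, v)) = p"
      using p by auto
    show "(case case p of (A, v) \<Rightarrow> (A - {v}, v) of (B, v) \<Rightarrow> f B) = (case p of (A, v) \<Rightarrow> f (A - {v}))"
      using p by auto
  next
    fix p assume "p \<in> Sigma (cliques n G r) (extensions n G)"
    then obtain B v where p: "p = (B, v)" "B \<in> cliques n G r" "v \<in> extensions n G B" by auto
    then have "finite B" by (auto dest: cliquesD)
    then show "(case p of (B, v) \<Rightarrow> (insert v B, v)) \<in> Sigma (cliques n G (Suc r)) (\<lambda>A. A)"
      using p by (auto simp: cliques_def extensions_def)
    show "(case case p of (B, v) \<Rightarrow> (insert v B, v) of (A, v) \<Rightarrow> (A - {v}, v)) = p"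
      using p by (auto simp: extensions_def)
  qed
  also have "\<dots> = (\<Sum>B\<in>cliques n G r. \<Sum>v\<in>extensions n G B. f B)"
    by (rule sum.Sigma[symmetric]) auto
  finally show ?thesis by simp
qed

lemma sum_card_extensions:
  "(\<Sum>B\<in>cliques n G r. card (extensions n G B)) = Suc r * card (cliques n G (Suc r))"
proof -
  have "(\<Sum>B\<in>cliques n G r. card (extensions n G B)) = (\<Sum>A\<in>cliques n G (Suc r). card A)"
    using sum_cliques_delete[of "\<lambda>_. 1" n G r] by simp
  also have "\<dots> = (\<Sum>A\<in>cliques n G (Suc r). Suc r)"
    by (rule sum.cong) (auto simp: cliques_def)
  finally show ?thesis by simp
qed

text \<open>A vertex outside \<open>extensions n G A\<close> lies in at most one of the sets \<open>extensions n G (A - {w})\<close>.\<close>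

lemma sum_extensions_delete_le:
  assumes A: "A \<in> cliques n G (Suc r)"
  shows "(\<Sum>w\<in>A. card (extensions n G (A - {w}))) \<le> r * card (extensions n G A) + n"
proof -
  have finA: "finite A" and cA: "card A = Suc r" using A by (auto dest: cliquesD)
  have card_eq: "card (extensions n G B) = (\<Sum>v<n. of_bool (v \<in> extensions n G B))" for B
  proof -
    have "{v \<in> {..<n}. v \<in> extensions n G B} = extensions n G B" by (auto simp: extensions_def)
    then show ?thesis by (simp add: sum_of_bool_eq Int_def)
  qed
  have "(\<Sum>w\<in>A. card (extensions n G (A - {w}))) =
      (\<Sum>v<n. \<Sum>w\<in>A. of_bool (v \<in> extensions n G (A - {w})))"
    unfolding card_eq by (rule sum.swap)
  also have "\<dots> \<le> (\<Sum>v<n. r * of_bool (v \<in> extensions n G A) + 1)"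
  proof (rule sum_mono)
    fix v
    have eq: "(\<Sum>w\<in>A. of_bool (v \<in> extensions n G (A - {w}))) = card {w\<in>A. v \<in> extensions n G (A - {w})}"
      using finA by (simp add: sum_of_bool_eq Int_def)
    show "(\<Sum>w\<in>A. of_bool (v \<in> extensions n G (A - {w}))) \<le> r * of_bool (v \<in> extensions n G A) + 1"
    proof (cases "v \<in> extensions n G A")
      case True
      have "card {w\<in>A. v \<in> extensions n G (A - {w})} \<le> card A"
        by (rule card_mono) (use finA in auto)
      with True show ?thesis unfolding eq by (simp add: cA)
    next
      case False
      have "w = w'" if w: "w \<in> A" "v \<in> extensions n G (A - {w})" "w' \<in> A" "v \<in> extensions n G (A - {w'})" for w w'
      proof (rule ccontr)
        assume "w \<noteq> w'"
        then have "v \<notin> A" using w by (auto simp: extensions_def)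
        moreover have "clique G (insert v A)"
          unfolding clique_def
        proof (intro ballI impI)
          fix x y assume "x \<in> insert v A" "y \<in> insert v A" "x \<noteq> y"
          moreover have "clique G A" using A by (auto dest: cliquesD)
          ultimately show "G x y"
            using w \<open>w \<noteq> w'\<close> by (auto simp: clique_def extensions_def)
        qed
        ultimately show False using False w by (auto simp: extensions_def)
      qed
      then have "card {w\<in>A. v \<in> extensions n G (A - {w})} \<le> 1"
        unfolding One_nat_def using finA by (subst card_le_Suc0_iff_eq) auto
      then show ?thesis unfolding eq by simp
    qed
  qed
  also have "\<dots> = r * card (extensions n G A) + n"
    by (simp only: sum.distrib sum_distrib_left[symmetric] card_eq[symmetric]) simp
  finally show ?thesis .
qed

text \<open>Cauchy--Schwarz for the extension numbers of the \<open>r\<close>-cliques. Double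
  counting turns the sum of their squares into a sum over the facets of the
  \<open>Suc r\<close>-cliques, which \<open>sum_extensions_delete_le\<close> bounds one clique at a
  time.\<close>

lemma moon_moser:
  "(real (Suc r) * card (cliques n G (Suc r)))\<^sup>2 \<le> card (cliques n G r) *
    (real r * (real (Suc (Suc r)) * card (cliques n G (Suc (Suc r)))) + real n * card (cliques n G (Suc r)))"
proof -
  let ?d = "\<lambda>B. card (extensions n G B)"
  have "(\<Sum>B\<in>cliques n G r. ?d B * ?d B) = (\<Sum>A\<in>cliques n G (Suc r). \<Sum>v\<in>A. ?d (A - {v}))"
    by (rule sum_cliques_delete[symmetric])
  also have "\<dots> \<le> (\<Sum>A\<in>cliques n G (Suc r). r * ?d A + n)"
    by (rule sum_mono) (rule sum_extensions_delete_le)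
  also have "\<dots> = r * ((Suc (Suc r)) * card (cliques n G (Suc (Suc r)))) + n * card (cliques n G (Suc r))"
    using sum_card_extensions[of n G "Suc r"] by (simp add: sum.distrib sum_distrib_left[symmetric])
  finally have *: "real (\<Sum>B\<in>cliques n G r. ?d B * ?d B) \<le>
      real (r * ((Suc (Suc r)) * card (cliques n G (Suc (Suc r)))) + n * card (cliques n G (Suc r)))"
    by (rule of_nat_mono)
  have "(real (Suc r) * card (cliques n G (Suc r)))\<^sup>2 = (\<Sum>B\<in>cliques n G r. real (?d B))\<^sup>2"
    using sum_card_extensions[of n G r] by (simp flip: of_nat_sum of_nat_mult of_nat_Suc)
  also have "\<dots> \<le> card (cliques n G r) * (\<Sum>B\<in>cliques n G r. (real (?d B))\<^sup>2)"
    using sum_squared_le_sum_of_squares[of "\<lambda>B. real (?d B)" "cliques n G r"] by (simp add: mult.commute)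
  also have "\<dots> \<le> card (cliques n G r) * real (r * ((Suc (Suc r)) * card (cliques n G (Suc (Suc r)))) + n * card (cliques n G (Suc r)))"
    using * by (intro mult_left_mono) (simp_all add: power2_eq_square)
  finally show ?thesis by (simp add: algebra_simps)
qed

text \<open>For positive \<open>n\<close> this is the proportion of all \<open>r\<close>-tuples of
  vertices, repetitions allowed, whose entries are distinct and form a clique. Normalizing by
  \<open>n ^ r\<close> cancels every \<open>n\<close> from the Moon--Moser inequality, and
  asymptotically it agrees with \<open>clique_density\<close>.\<close>

definition clique_ratio :: "nat \<Rightarrow> (nat \<Rightarrow> nat \<Rightarrow> bool) \<Rightarrow> nat \<Rightarrow> real" where
  "clique_ratio n G r = fact r * card (cliques n G r) / real n ^ r"

lemma clique_ratio_nonneg: "0 \<le> clique_ratio n G r"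
  by (simp add: clique_ratio_def)

lemma clique_ratio_0 [simp]: "clique_ratio n G 0 = 1"
proof -
  have "cliques n G 0 = {{}}" by (auto simp: cliques_def clique_def dest: finite_subset)
  then show ?thesis by (simp add: clique_ratio_def)
qed

lemma clique_ratio_Suc_le:
  assumes "0 < n"
  shows "clique_ratio n G (Suc r) \<le> clique_ratio n G r"
proof -
  have "Suc r * card (cliques n G (Suc r)) \<le> (\<Sum>B\<in>cliques n G r. n)"
    unfolding sum_card_extensions[symmetric] by (rule sum_mono) (rule card_extensions_le)
  then have "real (Suc r * card (cliques n G (Suc r))) \<le> real (n * card (cliques n G r))"
    by (intro of_nat_mono) (simp add: mult.commute)
  then have "fact r * (real (Suc r) * card (cliques n G (Suc r))) \<le> fact r * (real n * card (cliques n G r))"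
    by (intro mult_left_mono) (simp_all del: of_nat_Suc mult_Suc)
  then have *: "fact r * (real (Suc r) * card (cliques n G (Suc r))) / (real n * real n ^ r) \<le>
      fact r * (real n * card (cliques n G r)) / (real n * real n ^ r)"
    by (rule divide_right_mono) simp
  have "clique_ratio n G (Suc r) = fact r * (real (Suc r) * card (cliques n G (Suc r))) / (real n * real n ^ r)"
    by (simp add: clique_ratio_def algebra_simps)
  also note *
  also have "fact r * (real n * card (cliques n G r)) / (real n * real n ^ r) = clique_ratio n G r"
    using assms by (simp add: clique_ratio_def)
  finally show ?thesis .
qed

lemma clique_ratio_antimono: "0 < n \<Longrightarrow> r \<le> s \<Longrightarrow> clique_ratio n G s \<le> clique_ratio n G r"
  by (rule lift_Suc_antimono_le[of "clique_ratio n G"]) (auto intro: clique_ratio_Suc_le)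

lemma clique_ratio_le_1: "0 < n \<Longrightarrow> clique_ratio n G r \<le> 1"
  using clique_ratio_antimono[of n 0 r G] by simp

lemma clique_ratio_moon_moser:
  assumes "0 < n"
  shows "real (Suc r) * (clique_ratio n G (Suc r))\<^sup>2 \<le>
    clique_ratio n G r * (real r * clique_ratio n G (Suc (Suc r)) + clique_ratio n G (Suc r))"
proof -
  have card: "real (card (cliques n G s)) = clique_ratio n G s * real n ^ s / fact s" for s
    using assms by (simp add: clique_ratio_def)
  let ?h = "clique_ratio n G"
  let ?k = "real n ^ r * real n ^ r * real n * real n / (fact r * fact (Suc r))"
  have "?k > 0" using assms by simp
  have l: "(real (Suc r) * card (cliques n G (Suc r)))\<^sup>2 = ?k * (real (Suc r) * (?h (Suc r))\<^sup>2)"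
    unfolding card by (simp add: power2_eq_square field_simps del: of_nat_Suc)
  have r: "card (cliques n G r) *
      (real r * (real (Suc (Suc r)) * card (cliques n G (Suc (Suc r)))) + real n * card (cliques n G (Suc r))) =
      ?k * (?h r * (real r * ?h (Suc (Suc r)) + ?h (Suc r)))"
    unfolding card by (simp add: field_simps power2_eq_square del: of_nat_Suc)
  show ?thesis
    using moon_moser[of r n G] \<open>?k > 0\<close> unfolding l r by (simp only: mult_le_cancel_left_pos)
qed

text \<open>The quotient \<open>h (Suc s) / h s\<close> is at most \<open>(l - s) / l\<close>, by
  downward induction from \<open>s = l\<close>, where \<open>h (Suc l) = 0\<close> starts it.
  Multiplying these bounds gives the product.\<close>

lemma moon_moser_limit:
  fixes h :: "nat \<Rightarrow> real"
  assumes l: "0 < l" and nonneg: "\<And>j. j \<le> Suc l \<Longrightarrow> 0 \<le> h j" and h0: "h 0 \<le> 1"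
    and mm: "\<And>s. s < l \<Longrightarrow> real (Suc s) * (h (Suc s))\<^sup>2 \<le> h s * (real s * h (Suc (Suc s)) + h (Suc s))"
    and zero: "h (Suc l) = 0" and t: "t \<le> Suc l"
  shows "h t \<le> (\<Prod>j<t. 1 - real j / real l)"
proof -
  have step: "real l * h (Suc s) \<le> (real l - real s) * h s" if "s \<le> l" for s
    using that
  proof (induction s rule: inc_induct)
    case base
    then show ?case using zero by simp
  next
    case (step s)
    then have s: "s < l" "0 \<le> h s" "0 \<le> h (Suc s)" using nonneg by auto
    show ?case
    proof (cases "h (Suc s) = 0")
      case True
      then show ?thesis using s by simp
    next
      case False
      then have pos: "0 < h (Suc s)" using s by simp
      have "real l * (real (Suc s) * (h (Suc s))\<^sup>2) \<le> real l * (h s * (real s * h (Suc (Suc s)) + h (Suc s)))"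
        using mm[OF s(1)] by (intro mult_left_mono) auto
      also have "\<dots> = h s * (real s * (real l * h (Suc (Suc s))) + real l * h (Suc s))"
        by (simp add: algebra_simps)
      also have "\<dots> \<le> h s * (real s * ((real l - real (Suc s)) * h (Suc s)) + real l * h (Suc s))"
        using step.IH s by (intro mult_left_mono add_mono) auto
      \<comment> \<open>The step closes because \<open>s * (l - s - 1) + l\<close> factors as
        \<open>(s + 1) * (l - s)\<close>.\<close>
      also have "\<dots> = (real (Suc s) * h (Suc s)) * ((real l - real s) * h s)"
        by (simp add: algebra_simps)
      finally have "(real (Suc s) * h (Suc s)) * (real l * h (Suc s)) \<le> (real (Suc s) * h (Suc s)) * ((real l - real s) * h s)"
        by (simp add: power2_eq_square algebra_simps)
      then show ?thesis using pos by (subst (asm) mult_le_cancel_left_pos) auto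
    qed
  qed
  show ?thesis
    using t
  proof (induction t)
    case (Suc t)
    then have t: "t \<le> l" by simp
    have "h (Suc t) \<le> (1 - real t / real l) * h t"
      using step[OF t] l by (simp add: field_simps)
    also have "\<dots> \<le> (1 - real t / real l) * (\<Prod>j<t. 1 - real j / real l)"
      using Suc t l by (intro mult_left_mono) (auto simp: field_simps)
    finally show ?case by (simp add: mult.commute)
  qed (simp add: h0)
qed

section \<open>Complete multipartite patterns in dense families\<close>

lemma finite_lists_below [simp]: "finite {xs. length xs = r \<and> set xs \<subseteq> {..<n::nat}}"
  using finite_lists_length_eq[of "{..<n}" r] by (simp add: conj_commute)

lemma card_lists_below: "card {xs. length xs = r \<and> set xs \<subseteq> {..<n::nat}} = n ^ r"
  using card_lists_length_eq[of "{..<n}" r] by (simp add: conj_commute)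

text \<open>Erdos's theorem on complete \<open>r\<close>-partite subhypergraphs. In the induction step a pigeonhole
  over the \<open>s\<close>-subsets \<open>X\<close> of the vertex set finds one that is contained in the link of a positive
  fraction of the tails.\<close>

lemma dense_lists_contain_box:
  assumes s: "0 < s"
  shows "0 < \<epsilon> \<Longrightarrow> \<exists>n0. \<forall>n\<ge>n0. \<forall>P \<subseteq> {xs. length xs = r \<and> set xs \<subseteq> {..<n::nat}}.
    \<epsilon> * real n ^ r \<le> real (card P) \<longrightarrow>
    (\<exists>Xs. length Xs = r \<and> (\<forall>X\<in>set Xs. X \<subseteq> {..<n} \<and> card X = s) \<and> listset Xs \<subseteq> P)"
proof (induction r arbitrary: \<epsilon>)
  case 0
  have "listset [] \<subseteq> P" if "P \<subseteq> {xs. length xs = 0 \<and> set xs \<subseteq> {..<n::nat}}" "\<epsilon> * real n ^ 0 \<le> real (card P)" for n P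
  proof -
    have "P \<noteq> {}" using that 0 by auto
    with that(1) show ?thesis by auto
  qed
  then show ?case by (intro exI[of _ 0] allI impI exI[of _ "[]"] conjI) auto
next
  case (Suc r)
  \<comment> \<open>At least \<open>\<epsilon> / 2 * n ^ r\<close> tails have a link of size at
    least \<open>\<epsilon> / 2 * n\<close>. Each such link contains at least
    \<open>(\<epsilon> * n / (2 * s)) ^ s\<close> of the at most \<open>n ^ s\<close> sets of size
    \<open>s\<close>; averaging over these sets gives \<open>\<delta>\<close>.\<close>
  define \<delta> where "\<delta> = \<epsilon> / 2 * (\<epsilon> / (2 * real s)) ^ s"
  have "\<delta> > 0" using Suc.prems s by (simp add: \<delta>_def)
  then obtain n0 where n0: "\<And>n P. n \<ge> n0 \<Longrightarrow> P \<subseteq> {xs. length xs = r \<and> set xs \<subseteq> {..<n::nat}} \<Longrightarrow>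
      \<delta> * real n ^ r \<le> real (card P) \<Longrightarrow>
      \<exists>Xs. length Xs = r \<and> (\<forall>X\<in>set Xs. X \<subseteq> {..<n} \<and> card X = s) \<and> listset Xs \<subseteq> P"
    using Suc.IH by meson
  \<comment> \<open>The last term ensures that a link of size \<open>\<epsilon> / 2 * n\<close> has
    at least \<open>s\<close> elements, as the lower bound on the binomial coefficient
    needs.\<close>
  define n1 where "n1 = Max {n0, s, nat \<lceil>2 * real s / \<epsilon>\<rceil>}"
  show ?case
  proof (intro exI[of _ n1] allI impI)
    fix n P
    assume n: "n1 \<le> n" and P: "P \<subseteq> {xs. length xs = Suc r \<and> set xs \<subseteq> {..<n::nat}}"
      and card: "\<epsilon> * real n ^ Suc r \<le> real (card P)"
    have n': "n0 \<le> n" "s \<le> n" "0 < n" using n s by (auto simp: n1_def)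
    have "nat \<lceil>2 * real s / \<epsilon>\<rceil> \<le> n" using n by (auto simp: n1_def)
    then have ns: "real s \<le> \<epsilon> / 2 * real n" using Suc.prems by (simp add: field_simps nat_ceiling_le_eq)
    define Y where "Y = {xs. length xs = r \<and> set xs \<subseteq> {..<n}}"
    define N where "N y = {x. x < n \<and> x # y \<in> P}" for y
    define Y' where "Y' = {y\<in>Y. \<epsilon> / 2 * real n \<le> card (N y)}"
    define \<S> where "\<S> = {X. X \<subseteq> {..<n} \<and> card X = s}"
    have "finite Y" unfolding Y_def by (rule finite_lists_below)
    then have fin: "finite Y" "finite Y'" "finite (N y)" "finite \<S>" for y
      by (auto simp: Y'_def N_def \<S>_def)
    have card_\<S>: "card \<S> = n choose s" by (simp add: \<S>_def n_subsets)
    have "card P = (\<Sum>y\<in>Y. card (N y))"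
    proof -
      have P': "\<exists>y ys. xs = y # ys \<and> y < n \<and> length ys = r \<and> set ys \<subseteq> {..<n}" if "xs \<in> P" for xs
      proof -
        from that P have "length xs = Suc r" "set xs \<subseteq> {..<n}" by auto
        then show ?thesis by (cases xs) auto
      qed
      have "card P = card (Sigma Y N)"
      proof (rule bij_betw_same_card[of "\<lambda>xs. (tl xs, hd xs)"], rule bij_betw_byWitness[where f' = "\<lambda>(y, x). x # y"])
        show "\<forall>xs\<in>P. (case (tl xs, hd xs) of (y, x) \<Rightarrow> x # y) = xs" by (auto dest: P')
        show "(\<lambda>xs. (tl xs, hd xs)) ` P \<subseteq> Sigma Y N"
        proof (rule image_subsetI)
          fix xs assume "xs \<in> P"
          with P'[OF this] show "(tl xs, hd xs) \<in> Sigma Y N" by (auto simp: Y_def N_def)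
        qed
      qed (auto simp: Y_def N_def)
      then show ?thesis using fin by (simp add: card_SigmaI)
    qed
    also have "\<dots> \<le> (\<Sum>y\<in>Y. if y \<in> Y' then real n else \<epsilon> / 2 * real n)"
    proof -
      have "card (N y) \<le> card {..<n}" for y by (rule card_mono) (auto simp: N_def)
      then show ?thesis unfolding of_nat_sum by (intro sum_mono) (auto simp: Y'_def)
    qed
    also have "\<dots> \<le> (\<Sum>y\<in>Y. (if y \<in> Y' then real n else 0) + \<epsilon> / 2 * real n)"
      using Suc.prems by (intro sum_mono) auto
    also have "\<dots> = real n * card Y' + real n ^ r * (\<epsilon> / 2 * real n)"
    proof -
      have "(\<Sum>y\<in>Y. if y \<in> Y' then real n else 0) = (\<Sum>y\<in>Y \<inter> Y'. real n)"
        using fin by (intro sum.inter_restrict[symmetric])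
      moreover have "Y \<inter> Y' = Y'" by (auto simp: Y'_def)
      moreover have "card Y = n ^ r" by (simp add: Y_def card_lists_below)
      ultimately show ?thesis by (simp add: sum.distrib)
    qed
    finally have "real n * (\<epsilon> / 2 * real n ^ r) \<le> real n * card Y'"
      using card by (simp add: algebra_simps)
    then have Y': "\<epsilon> / 2 * real n ^ r \<le> card Y'"
      using n' by (subst (asm) mult_le_cancel_left_pos) auto
    have "\<exists>X\<in>\<S>. \<delta> * real n ^ r \<le> card {y\<in>Y'. X \<subseteq> N y}"
    proof (rule ccontr)
      assume "\<not> ?thesis"
      then have less: "real (card {y\<in>Y'. X \<subseteq> N y}) < \<delta> * real n ^ r" if "X \<in> \<S>" for X
        using that by force
      have "(\<epsilon> / 2 * real n ^ r) * (\<epsilon> / (2 * real s) * real n) ^ s \<le> card Y' * (\<epsilon> / (2 * real s) * real n) ^ s"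
        using Y' Suc.prems by (intro mult_right_mono) auto
      also have "\<dots> = (\<Sum>y\<in>Y'. (\<epsilon> / (2 * real s) * real n) ^ s)" by simp
      also have "\<dots> \<le> (\<Sum>y\<in>Y'. real (card {X\<in>\<S>. X \<subseteq> N y}))"
      proof (rule sum_mono)
        fix y assume "y \<in> Y'"
        then have y: "\<epsilon> / 2 * real n \<le> card (N y)" by (simp add: Y'_def)
        then have "s \<le> card (N y)" using ns by linarith
        have "{X\<in>\<S>. X \<subseteq> N y} = {X. X \<subseteq> N y \<and> card X = s}" by (auto simp: \<S>_def N_def)
        then have "card {X\<in>\<S>. X \<subseteq> N y} = card (N y) choose s" using fin by (simp add: n_subsets)
        moreover have "(\<epsilon> / (2 * real s) * real n) ^ s \<le> (real (card (N y)) / real s) ^ s"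
          using y s Suc.prems by (intro power_mono) (auto simp: field_simps)
        ultimately show "(\<epsilon> / (2 * real s) * real n) ^ s \<le> real (card {X\<in>\<S>. X \<subseteq> N y})"
          using binomial_ge_n_over_k_pow_k[OF \<open>s \<le> card (N y)\<close>, where 'a = real] by simp
      qed
      also have "\<dots> = (\<Sum>X\<in>\<S>. real (card {y\<in>Y'. X \<subseteq> N y}))"
      proof -
        have "(\<Sum>y\<in>Y'. real (card {X\<in>\<S>. X \<subseteq> N y})) = (\<Sum>y\<in>Y'. \<Sum>X\<in>{X\<in>\<S>. X \<subseteq> N y}. 1)" by simp
        also have "\<dots> = (\<Sum>X\<in>\<S>. \<Sum>y\<in>{y\<in>Y'. X \<subseteq> N y}. 1)"
          by (rule sum.swap_restrict) (use fin in auto)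
        finally show ?thesis by simp
      qed
      also have "\<dots> < (\<Sum>X\<in>\<S>. \<delta> * real n ^ r)"
      proof (rule sum_strict_mono)
        have "card \<S> \<noteq> 0" using n' by (simp add: card_\<S>)
        then show "\<S> \<noteq> {}" by auto
      qed (use fin less in auto)
      also have "\<dots> = real (n choose s) * (\<delta> * real n ^ r)" by (simp add: card_\<S>)
      also have "\<dots> \<le> real (n ^ s) * (\<delta> * real n ^ r)"
        using \<open>\<delta> > 0\<close> binomial_le_pow[OF n'(2)] by (intro mult_right_mono of_nat_mono) auto
      also have "\<dots> = (\<epsilon> / 2 * real n ^ r) * (\<epsilon> / (2 * real s) * real n) ^ s"
        unfolding \<delta>_def by (simp only: power_mult_distrib of_nat_power) (simp only: ac_simps)
      finally show False by simp
    qed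
    then obtain X where X: "X \<in> \<S>" "\<delta> * real n ^ r \<le> card {y\<in>Y'. X \<subseteq> N y}" by blast
    have "{y\<in>Y'. X \<subseteq> N y} \<subseteq> {xs. length xs = r \<and> set xs \<subseteq> {..<n}}" by (auto simp: Y'_def Y_def)
    from n0[OF n'(1) this X(2)] obtain Xs where Xs: "length Xs = r"
      "\<forall>X\<in>set Xs. X \<subseteq> {..<n} \<and> card X = s" "listset Xs \<subseteq> {y\<in>Y'. X \<subseteq> N y}"
      by blast
    then have "listset (X # Xs) \<subseteq> P" by (auto simp: set_Cons_def N_def)
    with Xs X(1) show "\<exists>Xs. length Xs = Suc r \<and> (\<forall>X\<in>set Xs. X \<subseteq> {..<n} \<and> card X = s) \<and> listset Xs \<subseteq> P"
      by (intro exI[of _ "X # Xs"]) (auto simp: \<S>_def)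
  qed
qed

lemma listset_memI:
  "length ys = length Xs \<Longrightarrow> (\<And>i. i < length Xs \<Longrightarrow> ys ! i \<in> Xs ! i) \<Longrightarrow> ys \<in> listset Xs"
proof (induction Xs arbitrary: ys)
  case (Cons X Xs)
  then obtain y ys' where ys: "ys = y # ys'" by (cases ys) auto
  have "y \<in> X" using Cons.prems(2)[of 0] ys by simp
  moreover have "ys' \<in> listset Xs"
    using Cons.prems(1) Cons.prems(2)[of "Suc i" for i] ys by (intro Cons.IH) auto
  ultimately show ?case by (simp add: ys set_Cons_def)
qed simp

text \<open>Each clique is entered once, as its sorted list, instead of in all \<open>fact l\<close>
  orders; hence \<open>\<epsilon> / fact l\<close>. Two elements from different sides of a box lie
  on a common transversal, which is a clique. So the sides are disjoint and completely
  joined.\<close>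

lemma clique_ratio_bounds_turan:
  assumes l: "0 < l" and s: "0 < s" and "0 < \<epsilon>"
  shows "\<exists>n0. \<forall>n\<ge>n0. \<forall>G. \<not> subgraph s (turan s l) n G \<longrightarrow> clique_ratio n G l < \<epsilon>"
proof -
  have "0 < \<epsilon> / fact l" using assms by simp
  from dense_lists_contain_box[OF s this, of l] obtain n0 where n0: "\<And>n P. n \<ge> n0 \<Longrightarrow>
      P \<subseteq> {xs. length xs = l \<and> set xs \<subseteq> {..<n::nat}} \<Longrightarrow> \<epsilon> / fact l * real n ^ l \<le> real (card P) \<Longrightarrow>
      \<exists>Xs. length Xs = l \<and> (\<forall>X\<in>set Xs. X \<subseteq> {..<n} \<and> card X = s) \<and> listset Xs \<subseteq> P"
    by meson
  have "subgraph s (turan s l) n G" if n: "Suc n0 \<le> n" and ratio: "\<epsilon> \<le> clique_ratio n G l" for n G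
  proof -
    let ?P = "sorted_list_of_set ` cliques n G l"
    have inj: "inj_on sorted_list_of_set (cliques n G l)"
      by (rule inj_on_inverseI[of _ set]) (auto dest!: cliquesD)
    have "?P \<subseteq> {xs. length xs = l \<and> set xs \<subseteq> {..<n}}"
      by (auto dest!: cliquesD)
    moreover have "\<epsilon> / fact l * real n ^ l \<le> real (card ?P)"
      using ratio n by (simp add: card_image[OF inj] clique_ratio_def field_simps)
    ultimately obtain Xs where Xs: "length Xs = l" "\<And>X. X \<in> set Xs \<Longrightarrow> X \<subseteq> {..<n} \<and> card X = s" "listset Xs \<subseteq> ?P"
      using n0[of n ?P] n by (meson Suc_leD)
    define g where "g i = sorted_list_of_set (Xs ! i)" for i
    have g: "length (g i) = s" "set (g i) = Xs ! i" "distinct (g i)" if "i < l" for i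
    proof -
      have "Xs ! i \<in> set Xs" using that Xs(1) by simp
      then have "Xs ! i \<subseteq> {..<n}" "card (Xs ! i) = s" using Xs(2) by blast+
      moreover from this have "finite (Xs ! i)" by (auto intro: finite_subset)
      ultimately show "length (g i) = s" "set (g i) = Xs ! i" "distinct (g i)" by (auto simp: g_def)
    qed
    have adj: "G x y \<and> x \<noteq> y" if ij: "i < l" "j < l" "i \<noteq> j" and xy: "x \<in> Xs ! i" "y \<in> Xs ! j" for i j x y
    proof -
      \<comment> \<open>The other entries of the transversal are arbitrary; first elements exist
        because \<open>0 < s\<close>.\<close>
      define ys where "ys = map (\<lambda>k. if k = i then x else if k = j then y else g k ! 0) [0..<l]"
      have "ys \<in> listset Xs"
        using Xs(1) xy s g by (intro listset_memI) (auto simp: ys_def simp flip: g(2))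
      then obtain A where A: "A \<in> cliques n G l" "ys = sorted_list_of_set A" using Xs(3) by auto
      then have A': "clique G A" "set ys = A" "distinct ys" by (auto dest: cliquesD)
      have "ys ! i = x" "ys ! j = y" "length ys = l" using ij by (auto simp: ys_def)
      then have "x \<noteq> y" "x \<in> A" "y \<in> A" using A' ij nth_mem by (auto simp: nth_eq_iff_index_eq)
      with A' show ?thesis by (auto simp: clique_def)
    qed
    \<comment> \<open>Vertex \<open>x\<close> of the Turan graph goes to position
      \<open>x div l\<close> in the side of its own part. Sides of size \<open>s\<close> are large
      enough, as \<open>x div l \<le> x < s\<close>.\<close>
    define f where "f x = g (x mod l) ! (x div l)" for x
    have div: "x div l < s" "x mod l < l" if "x < s" for x
      using that l by (auto intro: le_less_trans[OF div_le_dividend])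
    have f_in: "f x \<in> Xs ! (x mod l)" if "x < s" for x
      using div[OF that] g by (auto simp: f_def simp flip: g(2))
    have "inj_on f {..<s}"
    proof (rule inj_onI)
      fix x y assume xy: "x \<in> {..<s}" "y \<in> {..<s}" "f x = f y"
      then have "f x \<in> Xs ! (x mod l)" "f x \<in> Xs ! (y mod l)" using f_in[of x] f_in[of y] by auto
      then have "x mod l = y mod l" using adj[of "x mod l" "y mod l" "f x" "f x"] l by auto
      moreover from this have "x div l = y div l"
        using xy div[of x] div[of y] g by (auto simp: f_def nth_eq_iff_index_eq)
      ultimately show "x = y" by (metis div_mult_mod_eq)
    qed
    moreover have "f ` {..<s} \<subseteq> {..<n}"
    proof
      fix z assume "z \<in> f ` {..<s}"
      then obtain x where "x < s" "z = f x" by auto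
      then have "z \<in> Xs ! (x mod l)" "Xs ! (x mod l) \<in> set Xs" using f_in l Xs(1) by auto
      then show "z \<in> {..<n}" using Xs(2) by blast
    qed
    moreover have "G (f x) (f y)" if "turan s l x y" for x y
      using that adj[of "x mod l" "y mod l" "f x" "f y"] f_in l by (auto simp: turan_def)
    ultimately show ?thesis unfolding subgraph_def by blast
  qed
  then show ?thesis by (metis not_less)
qed

section \<open>The asymptotic upper bound on clique densities\<close>

lemma common_convergent_subseq:
  fixes h :: "nat \<Rightarrow> nat \<Rightarrow> real"
  assumes "\<And>k j. 0 \<le> h k j" "\<And>k j. h k j \<le> 1"
  shows "\<exists>r. strict_mono r \<and> (\<forall>j<J. convergent (\<lambda>k. h (r k) j))"
proof (induction J)
  case 0
  show ?case by (intro exI[of _ id]) (simp add: strict_mono_def)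
next
  case (Suc J)
  then obtain r where r: "strict_mono r" "\<And>j. j < J \<Longrightarrow> convergent (\<lambda>k. h (r k) j)" by blast
  \<comment> \<open>A monotone subsequence of a bounded sequence converges, and refining keeps the
    limits found before; with finitely many indices no diagonal sequence is needed.\<close>
  obtain q where q: "strict_mono q" "monoseq (\<lambda>k. h (r (q k)) J)"
    using seq_monosub[of "\<lambda>k. h (r k) J"] by blast
  have "Bseq (\<lambda>k. h (r (q k)) J)"
    by (rule BseqI'[of _ 1]) (simp add: assms)
  then have "convergent (\<lambda>k. h (r (q k)) J)" using q(2) by (rule Bseq_monoseq_convergent)
  moreover have "convergent (\<lambda>k. h (r (q k)) j)" if "j < J" for j
    using convergent_subseq_convergent[OF r(2)[OF that] q(1)] by (simp add: o_def)
  ultimately have "\<forall>j<Suc J. convergent (\<lambda>k. h ((r \<circ> q) k) j)" by (auto simp: less_Suc_eq)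
  then show ?case using strict_mono_o[OF r(1) q(1)] by blast
qed

lemma choose_over_power_limit: "(\<lambda>n. real (n choose t) / real n ^ t) \<longlonglongrightarrow> 1 / fact t"
proof -
  have "(\<lambda>n. (\<Prod>i<t. 1 - real i / real n) / fact t) \<longlonglongrightarrow> (\<Prod>i<t. 1 - 0) / fact t"
    by (rule tendsto_divide[OF tendsto_prod tendsto_const],
        rule tendsto_diff[OF tendsto_const lim_const_over_n]) simp
  moreover have "real (n choose t) / real n ^ t = (\<Prod>i<t. 1 - real i / real n) / fact t" if "0 < n" for n
  proof -
    have "(\<Prod>i<t. 1 - real i / real n) = (\<Prod>i<t. (real n - real i) / real n)"
      using that by (simp add: field_simps)
    also have "\<dots> = (\<Prod>i<t. real n - real i) / real n ^ t" by (simp add: prod_dividef)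
    finally show ?thesis
      by (simp add: binomial_gbinomial gbinomial_prod_rev atLeast0LessThan)
  qed
  then have "\<forall>\<^sub>F n in sequentially. (\<Prod>i<t. 1 - real i / real n) / fact t = real (n choose t) / real n ^ t"
    by (intro eventually_sequentiallyI[of 1]) simp
  ultimately show ?thesis by (auto intro: Lim_transform_eventually)
qed

lemma clique_density_ratio:
  "0 < n \<Longrightarrow> clique_density t n G = clique_ratio n G t / (fact t * (real (n choose t) / real n ^ t))"
  by (simp add: clique_density_eq clique_ratio_def)

text \<open>Counterexamples of growing size have a subsequence along which all relevant clique
  ratios converge. The limits satisfy the Moon--Moser inequalities, and the limit at
  \<open>Suc l\<close> vanishes because all the graphs omit one fixed Turan graph.\<close>

theorem erdos_stone_upper:
  assumes l: "0 < l" and "0 < \<epsilon>"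
  shows "\<forall>\<^sub>F n in sequentially. \<forall>G. \<not> subgraph s (turan s (Suc l)) n G \<longrightarrow>
    clique_density t n G \<le> (\<Prod>j<t. 1 - real j / real l) + \<epsilon>"
proof (rule ccontr)
  let ?c = "\<Prod>j<t. 1 - real j / real l"
  define bad where "bad n G \<longleftrightarrow> \<not> subgraph s (turan s (Suc l)) n G \<and> ?c + \<epsilon> < clique_density t n G" for n G
  assume "\<not> ?thesis"
  then have "\<forall>N. \<exists>n\<ge>N. \<exists>G. bad n G"
    by (auto simp: eventually_sequentially bad_def not_le)
  then have "\<exists>n G. Suc N \<le> n \<and> bad n G" for N by blast
  then obtain m F where m: "\<And>N. Suc N \<le> m N" and F: "\<And>N. bad (m N) (F N)" by metis
  \<comment> \<open>For \<open>s = 0\<close> the empty graph embeds into every graph, so none is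
    bad.\<close>
  have s: "0 < s"
    using F[of 0] by (cases s) (auto simp: bad_def subgraph_def)
  define h where "h N j = clique_ratio (m N) (F N) j" for N j
  have pos: "0 < m N" for N using m[of N] by simp
  have h01: "0 \<le> h N j" "h N j \<le> 1" for N j
    using pos by (simp_all add: h_def clique_ratio_nonneg clique_ratio_le_1)
  \<comment> \<open>Any bound above both \<open>t\<close> and \<open>l + 1\<close>, the indices that
    occur below, would serve.\<close>
  obtain r where r: "strict_mono r" "\<And>j. j < t + l + 3 \<Longrightarrow> convergent (\<lambda>k. h (r k) j)"
    using common_convergent_subseq[of h "t + l + 3"] h01 by blast
  define H where "H j = lim (\<lambda>k. h (r k) j)" for j
  have lim: "(\<lambda>k. h (r k) j) \<longlonglongrightarrow> H j" if "j < t + l + 3" for j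
    unfolding H_def using r(2)[OF that] by (simp add: convergent_LIMSEQ_iff)
  have m_top: "filterlim (\<lambda>k. m (r k)) sequentially sequentially"
  proof (rule filterlim_at_top_mono[OF filterlim_ident])
    have "k \<le> m (r k)" for k
      using m[of "r k"] seq_suble[OF r(1), of k] by simp
    then show "\<forall>\<^sub>F k in sequentially. k \<le> m (r k)" by simp
  qed
  have zero: "H (Suc l) = 0"
  proof (rule antisym)
    show "0 \<le> H (Suc l)" by (rule LIMSEQ_le_const[OF lim]) (auto simp: h01)
    show "H (Suc l) \<le> 0"
    proof (rule field_le_epsilon)
      fix e :: real assume "0 < e"
      then obtain n0 where n0: "\<And>n G. n0 \<le> n \<Longrightarrow> \<not> subgraph s (turan s (Suc l)) n G \<Longrightarrow> clique_ratio n G (Suc l) < e"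
        using clique_ratio_bounds_turan[of "Suc l" s e] s by blast
      have "\<forall>\<^sub>F k in sequentially. n0 \<le> m (r k)"
        using m_top by (simp add: filterlim_at_top)
      then have "\<forall>\<^sub>F k in sequentially. h (r k) (Suc l) \<le> e"
        by eventually_elim (use F n0 in \<open>auto simp: h_def bad_def intro: less_imp_le\<close>)
      then show "H (Suc l) \<le> 0 + e"
        using tendsto_upperbound[OF lim] by simp
    qed
  qed
  have H_le: "H t \<le> ?c"
  proof (cases "t \<le> Suc l")
    case True
    show ?thesis
    proof (rule moon_moser_limit[where h = H, OF l _ _ _ zero True])
      show "0 \<le> H j" if "j \<le> Suc l" for j
        by (rule LIMSEQ_le_const[OF lim]) (use that in \<open>auto simp: h01\<close>)
      show "H 0 \<le> 1" by (rule LIMSEQ_le_const2[OF lim]) (auto simp: h01)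
      fix q assume "q < l"
      show "real (Suc q) * (H (Suc q))\<^sup>2 \<le> H q * (real q * H (Suc (Suc q)) + H (Suc q))"
      proof (rule LIMSEQ_le)
        show "(\<lambda>k. real (Suc q) * (h (r k) (Suc q))\<^sup>2) \<longlonglongrightarrow> real (Suc q) * (H (Suc q))\<^sup>2"
          by (intro tendsto_intros lim) (use \<open>q < l\<close> in simp)
        show "(\<lambda>k. h (r k) q * (real q * h (r k) (Suc (Suc q)) + h (r k) (Suc q)))
            \<longlonglongrightarrow> H q * (real q * H (Suc (Suc q)) + H (Suc q))"
          by (intro tendsto_intros lim) (use \<open>q < l\<close> in simp_all)
      qed (use clique_ratio_moon_moser[OF pos] in \<open>auto simp: h_def\<close>)
    qed
  next
    case False
    \<comment> \<open>Beyond \<open>l + 1\<close> the product contains the zero factor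
      \<open>j = l\<close>, and antitonicity of the ratios replaces the Moon--Moser
      argument.\<close>
    then have "\<exists>j<t. 1 - real j / real l = 0" using l by (intro exI[of _ l]) auto
    then have "?c = 0" by auto
    moreover have "H t \<le> H (Suc l)"
      by (rule LIMSEQ_le[OF lim lim]) (use False clique_ratio_antimono[OF pos] in \<open>auto simp: h_def\<close>)
    ultimately show ?thesis using zero by linarith
  qed
  have "(\<lambda>k. h (r k) t / (fact t * (real (m (r k) choose t) / real (m (r k)) ^ t))) \<longlonglongrightarrow> H t / (fact t * (1 / fact t))"
    by (rule tendsto_divide[OF lim tendsto_mult[OF tendsto_const
          filterlim_compose[OF choose_over_power_limit m_top]]]) simp_all
  then have "(\<lambda>k. clique_density t (m (r k)) (F (r k))) \<longlonglongrightarrow> H t"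
    by (simp add: clique_density_ratio[OF pos] h_def)
  then have "?c + \<epsilon> \<le> H t"
    by (rule LIMSEQ_le_const) (use F in \<open>auto simp: bad_def intro: less_imp_le\<close>)
  then show False using H_le \<open>0 < \<epsilon>\<close> by simp
qed

section \<open>Clique counts of Turan graphs\<close>

lemma card_cliques_turan_ge:
  assumes l: "0 < l"
  shows "(l choose t) * (n div l) ^ t \<le> card (cliques n (turan n l) t)"
proof -
  let ?m = "n div l"
  let ?P = "{P. P \<subseteq> {..<l} \<and> card P = t}"
  let ?D = "Sigma ?P (\<lambda>P. P \<rightarrow>\<^sub>E {..<?m})"
  \<comment> \<open>A clique is given by a set \<open>P\<close> of \<open>t\<close> parts and a
    block \<open>a p\<close> for each of them. Only the \<open>n div l\<close> complete blocks are
    used, so rounding costs nothing asymptotically.\<close>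
  let ?\<Phi> = "\<lambda>(P, a). (\<lambda>p. a p * l + p) ` P"
  have fin: "finite ?P" by (rule finite_subset[of _ "Pow {..<l}"]) auto
  have finP: "finite P" if "P \<in> ?P" for P
    by (rule finite_subset[of _ "{..<l}"]) (use that in auto)
  have "card ?D = (\<Sum>P\<in>?P. card (P \<rightarrow>\<^sub>E {..<?m}))"
  proof (rule card_SigmaI[OF fin], rule ballI)
    fix P assume "P \<in> ?P"
    from finP[OF this] show "finite (P \<rightarrow>\<^sub>E {..<?m})" by (rule finite_PiE) simp
  qed
  also have "\<dots> = (\<Sum>P\<in>?P. ?m ^ t)"
  proof (rule sum.cong[OF refl])
    fix P assume "P \<in> ?P"
    with finP[OF this] show "card (P \<rightarrow>\<^sub>E {..<?m}) = ?m ^ t" by (simp add: card_funcsetE)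
  qed
  also have "\<dots> = (l choose t) * ?m ^ t" by (simp add: n_subsets)
  finally have card: "card ?D = (l choose t) * ?m ^ t" .
  have mod: "(a * l + p) mod l = p" "(a * l + p) div l = a" if "p < l" for a p :: nat
    using that by auto
  have "inj_on ?\<Phi> ?D"
  proof (rule inj_onI, clarify)
    fix P a Q b
    assume P: "P \<subseteq> {..<l}" "a \<in> P \<rightarrow>\<^sub>E {..<?m}" and Q: "Q \<subseteq> {..<l}" "b \<in> Q \<rightarrow>\<^sub>E {..<?m}"
      and eq: "(\<lambda>p. a p * l + p) ` P = (\<lambda>p. b p * l + p) ` Q"
    have mods: "(\<lambda>x. x mod l) ` (\<lambda>p. c p * l + p) ` R = R" if "R \<subseteq> {..<l}" for R c
    proof -
      have "(\<lambda>p. (c p * l + p) mod l) ` R = (\<lambda>p. p) ` R"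
        using that by (intro image_cong refl mod(1)) blast
      then show ?thesis by (simp add: image_image)
    qed
    have PQ: "P = Q" using mods[OF P(1), of a] mods[OF Q(1), of b] eq by simp
    have "a p = b p" if "p \<in> P" for p
    proof -
      from that eq have "a p * l + p \<in> (\<lambda>p. b p * l + p) ` Q" by blast
      then obtain q where q: "q \<in> Q" "a p * l + p = b q * l + q" by auto
      have "p < l" "q < l" using that P(1) q(1) Q(1) by auto
      then have "p = q" "a p = b q"
        using mod[of p "a p"] mod[of q "b q"] unfolding q(2) by (blast intro: trans[OF sym])+
      then show ?thesis by simp
    qed
    then have "a = b" using Q(2) PQ by (intro PiE_ext[OF P(2)]) auto
    with PQ show "P = Q \<and> a = b" by simp
  qed
  moreover have "?\<Phi> ` ?D \<subseteq> cliques n (turan n l) t"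
  proof (rule image_subsetI)
    fix z assume "z \<in> ?D"
    then obtain P a where z: "z = (P, a)" and P: "P \<subseteq> {..<l}" "card P = t" "a \<in> P \<rightarrow>\<^sub>E {..<?m}"
      by blast
    have "\<And>p. p \<in> P \<Longrightarrow> a p * l + p < n"
    proof -
      fix p assume that: "p \<in> P"
      have "a p < ?m" "p < l" using that P by auto
      then have "Suc (a p) * l \<le> ?m * l" by (intro mult_right_mono) auto
      also have "\<dots> \<le> n" by simp
      finally show "a p * l + p < n" using \<open>p < l\<close> by simp
    qed
    moreover have "inj_on (\<lambda>p. a p * l + p) P"
    proof (rule inj_onI)
      fix p q assume "p \<in> P" "q \<in> P" and eq: "a p * l + p = a q * l + q"
      then have "p < l" "q < l" using P(1) by auto
      then show "p = q"
        using mod(1)[of p "a p"] mod(1)[of q "a q"] unfolding eq by (blast intro: trans[OF sym])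
    qed
    moreover have "clique (turan n l) ((\<lambda>p. a p * l + p) ` P)"
      unfolding clique_def
    proof (intro ballI impI)
      fix x y assume "x \<in> (\<lambda>p. a p * l + p) ` P" "y \<in> (\<lambda>p. a p * l + p) ` P" "x \<noteq> y"
      then obtain p q where pq: "p \<in> P" "q \<in> P" "x = a p * l + p" "y = a q * l + q" "p \<noteq> q" by blast
      then have "x mod l = p" "y mod l = q" using P(1) by auto
      with pq calculation(1) show "turan n l x y" by (auto simp: turan_def)
    qed
    ultimately show "?\<Phi> z \<in> cliques n (turan n l) t"
      using P(2) by (auto simp: z cliques_def card_image)
  qed
  ultimately show ?thesis unfolding card[symmetric] by (rule card_inj_on_le) simp
qed

lemma card_cliques_subgraph:
  assumes "subgraph n G n H"
  shows "card (cliques n G t) \<le> card (cliques n H t)"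
proof -
  obtain f where f: "inj_on f {..<n}" "f ` {..<n} \<subseteq> {..<n}" "\<And>x y. x < n \<Longrightarrow> y < n \<Longrightarrow> G x y \<Longrightarrow> H (f x) (f y)"
    using assms by (auto simp: subgraph_def)
  show ?thesis
  proof (rule card_inj_on_le[of "image f"])
    show "inj_on ((`) f) (cliques n G t)"
      by (rule inj_on_subset[OF inj_on_image_Pow[OF f(1)]]) (auto simp: cliques_def)
    show "(`) f ` cliques n G t \<subseteq> cliques n H t"
    proof clarify
      fix A assume A: "A \<in> cliques n G t"
      then have "A \<subseteq> {..<n}" "card A = t" "clique G A" by (auto dest: cliquesD)
      moreover from this have "card (f ` A) = card A" using f(1) by (intro card_image) (rule inj_on_subset)
      ultimately show "f ` A \<in> cliques n H t"
        using f(2) by (auto simp: cliques_def clique_def subset_iff intro!: f(3))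
    qed
  qed simp
qed

lemma choose_as_prod: "0 < l \<Longrightarrow> fact t * real (l choose t) / real l ^ t = (\<Prod>j<t. 1 - real j / real l)"
proof -
  assume l: "0 < l"
  have "(\<Prod>j<t. 1 - real j / real l) = (\<Prod>j<t. (real l - real j) / real l)"
    using l by (simp add: field_simps)
  also have "\<dots> = (\<Prod>j<t. real l - real j) / real l ^ t" by (simp add: prod_dividef)
  finally show ?thesis by (simp add: binomial_gbinomial gbinomial_prod_rev atLeast0LessThan)
qed

lemma turan_clique_limit:
  assumes l: "0 < l"
  shows "(\<lambda>n. real ((l choose t) * (n div l) ^ t) / real (n choose t)) \<longlonglongrightarrow> (\<Prod>j<t. 1 - real j / real l)"
proof -
  have "(\<lambda>n. real (n div l) / real n) \<longlonglongrightarrow> 1 / real l"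
  proof (rule tendsto_sandwich)
    show "\<forall>\<^sub>F n in sequentially. 1 / real l - 1 / real n \<le> real (n div l) / real n"
    proof (rule eventually_sequentiallyI[of 1])
      fix n :: nat assume n: "1 \<le> n"
      have "real n \<le> real (Suc (n div l) * l)"
        using dividend_less_div_times[OF l, of n] by (intro of_nat_mono) simp
      then have "real n / real l - 1 \<le> real (n div l)" using l by (simp add: field_simps)
      then have "(real n / real l - 1) / real n \<le> real (n div l) / real n"
        by (rule divide_right_mono) simp
      then show "1 / real l - 1 / real n \<le> real (n div l) / real n"
        using n by (simp add: diff_divide_distrib)
    qed
    show "\<forall>\<^sub>F n in sequentially. real (n div l) / real n \<le> 1 / real l"
    proof (rule eventually_sequentiallyI[of 1])
      fix n :: nat assume n: "1 \<le> n"
      have "real (n div l * l) \<le> real n" by (intro of_nat_mono) simp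
      then show "real (n div l) / real n \<le> 1 / real l" using n l by (simp add: field_simps)
    qed
    have "(\<lambda>n. 1 / real l - 1 / real n) \<longlonglongrightarrow> 1 / real l - 0"
      by (intro tendsto_intros lim_const_over_n)
    then show "(\<lambda>n. 1 / real l - 1 / real n) \<longlonglongrightarrow> 1 / real l" by simp
  qed simp
  then have "(\<lambda>n. real (l choose t) * (real (n div l) / real n) ^ t / (real (n choose t) / real n ^ t))
      \<longlonglongrightarrow> real (l choose t) * (1 / real l) ^ t / (1 / fact t)"
    by (rule tendsto_divide[OF tendsto_mult[OF tendsto_const tendsto_power] choose_over_power_limit]) simp_all
  moreover have "real (l choose t) * (1 / real l) ^ t / (1 / fact t) = (\<Prod>j<t. 1 - real j / real l)"
    by (subst choose_as_prod[OF l, symmetric]) (simp add: power_divide)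
  moreover have "\<forall>\<^sub>F n in sequentially. real (l choose t) * (real (n div l) / real n) ^ t / (real (n choose t) / real n ^ t) =
      real ((l choose t) * (n div l) ^ t) / real (n choose t)"
    by (intro eventually_sequentiallyI[of 1]) (simp add: power_divide)
  ultimately show ?thesis by (auto intro: Lim_transform_eventually)
qed

section \<open>Homogeneous models\<close>

lemma holds_transfer:
  assumes "\<And>i vs. set vs \<subseteq> qf_vars q \<Longrightarrow> R i (map \<sigma> vs) \<longleftrightarrow> R' i (map \<sigma>' vs)"
    and "\<And>a b. a \<in> qf_vars q \<Longrightarrow> b \<in> qf_vars q \<Longrightarrow> \<sigma> a = \<sigma> b \<longleftrightarrow> \<sigma>' a = \<sigma>' b"
  shows "holds R \<sigma> q \<longleftrightarrow> holds R' \<sigma>' q"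
  using assms
proof (induction q)
  case (Conj p q)
  have "holds R \<sigma> p \<longleftrightarrow> holds R' \<sigma>' p" by (rule Conj.IH(1)) (auto intro!: Conj.prems)
  moreover have "holds R \<sigma> q \<longleftrightarrow> holds R' \<sigma>' q" by (rule Conj.IH(2)) (auto intro!: Conj.prems)
  ultimately show ?case by simp
next
  case (Disj p q)
  have "holds R \<sigma> p \<longleftrightarrow> holds R' \<sigma>' p" by (rule Disj.IH(1)) (auto intro!: Disj.prems)
  moreover have "holds R \<sigma> q \<longleftrightarrow> holds R' \<sigma>' q" by (rule Disj.IH(2)) (auto intro!: Disj.prems)
  ultimately show ?case by simp
qed auto

lemma holds_cong_vars: "(\<And>v. v \<in> qf_vars q \<Longrightarrow> \<sigma> v = \<sigma>' v) \<Longrightarrow> holds R \<sigma> q \<longleftrightarrow> holds R \<sigma>' q"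
proof (rule holds_transfer)
  fix i vs assume "\<And>v. v \<in> qf_vars q \<Longrightarrow> \<sigma> v = \<sigma>' v" "set vs \<subseteq> qf_vars q"
  then have "map \<sigma> vs = map \<sigma>' vs" by (intro map_cong) auto
  then show "R i (map \<sigma> vs) \<longleftrightarrow> R i (map \<sigma>' vs)" by (rule arg_cong)
qed simp

definition pullback :: "nat list \<Rightarrow> nat \<Rightarrow> (nat \<Rightarrow> nat) \<Rightarrow> (nat \<Rightarrow> nat list \<Rightarrow> bool) \<Rightarrow> nat \<Rightarrow> nat list \<Rightarrow> bool" where
  "pullback L n g R i xs \<longleftrightarrow> i < length L \<and> length xs = L ! i \<and> set xs \<subseteq> {..<n} \<and> R i (map g xs)"

lemma holds_pullback:
  fixes \<sigma> :: "nat \<Rightarrow> nat"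
  assumes "is_struct L n' R" "inj_on g {..<n}" "\<And>v. \<sigma> v < n"
  shows "holds (pullback L n g R) \<sigma> q \<longleftrightarrow> holds R (\<lambda>v. g (\<sigma> v)) q"
proof (rule holds_transfer)
  fix i vs
  have "set (map \<sigma> vs) \<subseteq> {..<n}" using assms(3) by auto
  moreover have "i < length L \<and> length (map \<sigma> vs) = L ! i" if "R i (map (\<lambda>v. g (\<sigma> v)) vs)"
    using assms(1) that unfolding is_struct_def by fastforce
  ultimately show "pullback L n g R i (map \<sigma> vs) \<longleftrightarrow> R i (map (\<lambda>v. g (\<sigma> v)) vs)"
    by (auto simp: pullback_def comp_def)
next
  fix a b
  show "\<sigma> a = \<sigma> b \<longleftrightarrow> g (\<sigma> a) = g (\<sigma> b)"
    using assms(2,3) by (auto dest: inj_onD)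
qed

text \<open>Universal theories are closed under induced substructures; \<open>g\<close> names the
  vertices of the substructure.\<close>

lemma is_model_pullback:
  assumes "is_model L Ax n' R" "inj_on g {..<n}" "g ` {..<n} \<subseteq> {..<n'}"
  shows "is_model L Ax n (pullback L n g R)"
  unfolding is_model_def
proof (intro conjI allI impI ballI)
  show "is_struct L n (pullback L n g R)" by (auto simp: is_struct_def pullback_def)
  fix \<sigma> :: "nat \<Rightarrow> nat" and ax assume \<sigma>: "\<forall>v. \<sigma> v < n" and "ax \<in> set Ax"
  then have "holds R (\<lambda>v. g (\<sigma> v)) ax"
    using assms(1,3) unfolding is_model_def by (auto simp: image_subset_iff)
  then show "holds (pullback L n g R) \<sigma> ax"
    using holds_pullback[of L n' R g n \<sigma> ax] assms(1,2) \<sigma> by (simp add: is_model_def)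
qed

lemma interp_edge_pullback:
  assumes "is_model L Ax n' R" "inj_on g {..<n}" "x < n" "y < n"
  shows "interp_edge (pullback L n g R) \<phi> x y \<longleftrightarrow> interp_edge R \<phi> (g x) (g y)"
proof -
  have "interp_edge (pullback L n g R) \<phi> x y \<longleftrightarrow> holds R (\<lambda>v. g (if v = 0 then x else y)) \<phi>"
    unfolding interp_edge_def by (rule holds_pullback) (use assms in \<open>auto simp: is_model_def\<close>)
  also have "(\<lambda>v::nat. g (if v = 0 then x else y)) = (\<lambda>v. if v = 0 then g x else g y)" by auto
  finally show ?thesis by (simp add: interp_edge_def)
qed

text \<open>A vertex \<open>x\<close> lies in part \<open>x mod l\<close> and in block \<open>x div l\<close>. Two tuples have the same type if
  they have the same parts and the same order type of blocks.\<close>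

definition same_type :: "nat \<Rightarrow> nat list \<Rightarrow> nat list \<Rightarrow> bool" where
  "same_type l xs ys \<longleftrightarrow> length xs = length ys \<and>
    (\<forall>a<length xs. xs ! a mod l = ys ! a mod l \<and>
      (\<forall>b<length xs. (xs ! a div l < xs ! b div l) = (ys ! a div l < ys ! b div l)))"

lemma same_type_sym: "same_type l xs ys \<Longrightarrow> same_type l ys xs"
  by (auto simp: same_type_def)

lemma same_type_trans: "same_type l xs ys \<Longrightarrow> same_type l ys zs \<Longrightarrow> same_type l xs zs"
  by (auto simp: same_type_def)

lemma same_type_block_eq:
  assumes "same_type l xs ys" "a < length xs" "b < length xs"
  shows "xs ! a div l = xs ! b div l \<longleftrightarrow> ys ! a div l = ys ! b div l"
  using assms unfolding same_type_def by (metis linorder_less_linear order_less_irrefl)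

lemma same_type_nth_eq:
  assumes "same_type l xs ys" "a < length xs" "b < length xs"
  shows "xs ! a = xs ! b \<longleftrightarrow> ys ! a = ys ! b"
proof -
  have eq: "x = y \<longleftrightarrow> x div l = y div l \<and> x mod l = y mod l" for x y by (metis div_mult_mod_eq)
  show ?thesis
    using same_type_block_eq[OF assms] assms unfolding same_type_def eq[of "xs ! a"] eq[of "ys ! a"] by auto
qed

lemma same_type_pair_eq: "same_type l [x, y] [x', y'] \<Longrightarrow> x = y \<longleftrightarrow> x' = y'"
  using same_type_nth_eq[of l "[x, y]" "[x', y']" 0 1] by simp

lemma same_type_pair_mod: "same_type l [x, y] [x', y'] \<Longrightarrow> x mod l = x' mod l \<and> y mod l = y' mod l"
  by (auto simp: same_type_def less_Suc_eq)

section \<open>Relabelling blocks and compressing them to ranks\<close>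

definition block_map :: "nat \<Rightarrow> (nat \<Rightarrow> nat) \<Rightarrow> nat \<Rightarrow> nat" where
  "block_map l f x = f (x div l) * l + x mod l"

lemma block_map_div_mod:
  "0 < l \<Longrightarrow> block_map l f x div l = f (x div l)"
  "block_map l f x mod l = x mod l"
  by (simp_all add: block_map_def)

lemma block_map_less: "0 < l \<Longrightarrow> f (x div l) < m \<Longrightarrow> block_map l f x < l * m"
proof -
  assume l: "0 < l" and f: "f (x div l) < m"
  have "block_map l f x < Suc (f (x div l)) * l" using l by (simp add: block_map_def)
  also have "\<dots> \<le> m * l" using f by (intro mult_right_mono) auto
  finally show ?thesis by (simp add: mult.commute)
qed

lemma inj_on_block_map:
  assumes "0 < l" "inj_on f D" "\<And>x. x \<in> X \<Longrightarrow> x div l \<in> D"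
  shows "inj_on (block_map l f) X"
proof (rule inj_onI)
  fix x y assume "x \<in> X" "y \<in> X" "block_map l f x = block_map l f y"
  then have "f (x div l) = f (y div l)" "x mod l = y mod l"
    using block_map_div_mod assms(1) by metis+
  then have "x div l = y div l" using assms \<open>x \<in> X\<close> \<open>y \<in> X\<close> by (auto dest: inj_onD)
  then show "x = y" using \<open>x mod l = y mod l\<close> by (metis div_mult_mod_eq)
qed

lemma same_type_block_map:
  assumes "0 < l" "strict_mono_on D f" "\<And>x. x \<in> set xs \<Longrightarrow> x div l \<in> D"
  shows "same_type l xs (map (block_map l f) xs)"
proof -
  have "(f x < f y) = (x < y)" if "x \<in> D" "y \<in> D" for x y
    using assms(2) that by (metis strict_mono_on_less)
  then show ?thesis using assms(1,3) by (auto simp: same_type_def block_map_div_mod)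
qed

definition rank :: "nat set \<Rightarrow> nat \<Rightarrow> nat" where
  "rank D d = card {e\<in>D. e < d}"

lemma strict_mono_on_rank: "finite D \<Longrightarrow> strict_mono_on D (rank D)"
  by (rule strict_mono_onI) (auto simp: rank_def intro!: psubset_card_mono)

lemma rank_less: "finite D \<Longrightarrow> d \<in> D \<Longrightarrow> rank D d < card D"
  by (auto simp: rank_def intro!: psubset_card_mono)

lemma nth_rank:
  assumes "finite A" "a \<in> A"
  shows "sorted_list_of_set A ! rank A a = a"
proof -
  let ?s = "sorted_list_of_set A"
  have "a \<in> set ?s" using assms by simp
  then obtain j where j: "j < length ?s" "?s ! j = a" by (meson in_set_conv_nth)
  have less: "?s ! i < ?s ! i' \<longleftrightarrow> i < i'" if "i < length ?s" "i' < length ?s" for i i'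
    using that sorted_list_of_set.strict_sorted_key_list_of_set[of A]
    by (metis linorder_neqE_nat not_less_iff_gr_or_eq sorted_wrt_nth_less)
  have "{e\<in>A. e < a} = (!) ?s ` {..<j}"
  proof safe
    fix e assume "e \<in> A" "e < a"
    then have "e \<in> set ?s" using assms by simp
    then obtain i where "i < length ?s" "?s ! i = e" by (meson in_set_conv_nth)
    then show "e \<in> (!) ?s ` {..<j}" using j \<open>e < a\<close> less by auto
  next
    fix i assume "i < j"
    then have "?s ! i \<in> set ?s" using j by simp
    then show "?s ! i \<in> A" using assms by simp
    show "?s ! i < a" using less[of i j] \<open>i < j\<close> j by auto
  qed
  moreover have "inj_on ((!) ?s) {..<j}"
    using j by (auto simp: inj_on_def nth_eq_iff_index_eq)
  ultimately show ?thesis using j by (simp add: rank_def card_image)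
qed

lemma card_image_same_kernel:
  assumes "\<And>x y. x \<in> B \<Longrightarrow> y \<in> B \<Longrightarrow> f x = f y \<longleftrightarrow> g x = g y"
  shows "card (f ` B) = card (g ` B)"
proof (rule bij_betw_same_card[of "\<lambda>z. g (inv_into B f z)"], rule bij_betw_imageI)
  have inv: "inv_into B f (f x) \<in> B" "f (inv_into B f (f x)) = f x" if "x \<in> B" for x
    using that by (auto intro: inv_into_into f_inv_into_f)
  then have g: "g (inv_into B f (f x)) = g x" if "x \<in> B" for x using assms that by blast
  show "inj_on (\<lambda>z. g (inv_into B f z)) (f ` B)"
    by (rule inj_onI) (use assms g in auto)
  show "(\<lambda>z. g (inv_into B f z)) ` f ` B = g ` B"
    unfolding image_image by (rule image_cong) (use g in auto)
qed

text \<open>The rank counts distinct blocks, while \<open>same_type\<close> speaks about positions.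
  In both tuples the smaller blocks sit at the same positions and coincide at the same pairs of
  positions, so there are equally many.\<close>

lemma rank_same_type:
  assumes st: "same_type l xs ys" and a: "a < length xs"
  shows "rank ((\<lambda>x. x div l) ` set xs) (xs ! a div l) = rank ((\<lambda>x. x div l) ` set ys) (ys ! a div l)"
proof -
  let ?B = "{b. b < length xs \<and> xs ! b div l < xs ! a div l}"
  have B': "?B = {b. b < length ys \<and> ys ! b div l < ys ! a div l}" using st a by (auto simp: same_type_def)
  have img: "{e \<in> (\<lambda>x. x div l) ` set zs. e < c} = (\<lambda>b. zs ! b div l) ` {b. b < length zs \<and> zs ! b div l < c}" for zs c
    by (auto simp: set_conv_nth)
  have "card ((\<lambda>b. xs ! b div l) ` ?B) = card ((\<lambda>b. ys ! b div l) ` ?B)"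
    by (rule card_image_same_kernel) (use same_type_block_eq[OF st] in auto)
  then show ?thesis unfolding rank_def img B'[symmetric] .
qed

section \<open>Homogeneous models on boundedly many blocks\<close>

definition homogeneous :: "nat \<Rightarrow> nat \<Rightarrow> (nat \<Rightarrow> nat list \<Rightarrow> bool) \<Rightarrow> bool" where
  "homogeneous l N R \<longleftrightarrow> (\<forall>i xs ys. set xs \<subseteq> {..<N} \<longrightarrow> set ys \<subseteq> {..<N} \<longrightarrow> same_type l xs ys \<longrightarrow>
    (R i xs \<longleftrightarrow> R i ys))"

definition realizable :: "nat list \<Rightarrow> qf list \<Rightarrow> qf \<Rightarrow> (nat \<Rightarrow> nat \<Rightarrow> bool) \<Rightarrow> bool" where
  "realizable L Ax \<phi> Q \<longleftrightarrow> (\<forall>n. \<exists>R. is_model L Ax n R \<and> (\<forall>x<n. \<forall>y<n. Q x y \<longrightarrow> interp_edge R \<phi> x y))"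

definition certificate :: "nat list \<Rightarrow> qf list \<Rightarrow> qf \<Rightarrow> (nat \<Rightarrow> nat \<Rightarrow> bool) \<Rightarrow> nat \<Rightarrow> nat \<Rightarrow>
    (nat \<Rightarrow> nat list \<Rightarrow> bool) \<Rightarrow> bool" where
  "certificate L Ax \<phi> Q l m R \<longleftrightarrow> is_model L Ax (l * m) R \<and> homogeneous l (l * m) R \<and>
    (\<forall>x<l * m. \<forall>y<l * m. Q x y \<longrightarrow> interp_edge R \<phi> x y)"

text \<open>The blow-up \<open>R'\<close> gives a tuple the truth value of any tuple of its type in
  the certificate; by homogeneity the choice does not matter. The variables of an axiom meet at most
  \<open>m\<close> blocks, and ranks compress these into the certificate without changing types. An
  edge needs two blocks, hence \<open>2 \<le> m\<close>.\<close>

lemma certificate_imp_realizable: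
  assumes cert: "certificate L Ax \<phi> Q l m R" and l: "0 < l" and m: "2 \<le> m"
    and vars: "\<And>ax. ax \<in> set Ax \<Longrightarrow> qf_vars ax \<subseteq> {..<m}"
    and Q: "\<And>x y x' y'. same_type l [x, y] [x', y'] \<Longrightarrow> Q x y \<Longrightarrow> Q x' y'"
  shows "realizable L Ax \<phi> Q"
  unfolding realizable_def
proof
  fix n
  have model: "is_model L Ax (l * m) R" and hom: "homogeneous l (l * m) R"
    and edges: "\<And>x y. x < l * m \<Longrightarrow> y < l * m \<Longrightarrow> Q x y \<Longrightarrow> interp_edge R \<phi> x y"
    using cert by (auto simp: certificate_def)
  define R' where "R' i xs \<longleftrightarrow> i < length L \<and> length xs = L ! i \<and> set xs \<subseteq> {..<n} \<and>
      (\<exists>ys. set ys \<subseteq> {..<l * m} \<and> same_type l xs ys \<and> R i ys)" for i xs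
  have R': "R' i xs \<longleftrightarrow> R i ys" if "set xs \<subseteq> {..<n}" "set ys \<subseteq> {..<l * m}" "same_type l xs ys" for i xs ys
  proof
    assume "R' i xs"
    then obtain zs where "set zs \<subseteq> {..<l * m}" "same_type l xs zs" "R i zs" by (auto simp: R'_def)
    moreover from this have "same_type l zs ys" using that same_type_sym same_type_trans by blast
    ultimately show "R i ys" using hom that(2) by (auto simp: homogeneous_def)
  next
    assume "R i ys"
    moreover from this have "i < length L" "length ys = L ! i"
      using model by (auto simp: is_model_def is_struct_def)
    ultimately show "R' i xs" using that by (auto simp: R'_def same_type_def)
  qed
  have transfer: "\<exists>\<sigma>'. (\<forall>v. \<sigma>' v < l * m) \<and> (\<forall>vs. set vs \<subseteq> V \<longrightarrow> same_type l (map \<sigma> vs) (map \<sigma>' vs))"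
    if V: "finite V" "card V \<le> m" for V :: "nat set" and \<sigma> :: "nat \<Rightarrow> nat"
  proof -
    define D where "D = (\<lambda>v. \<sigma> v div l) ` V"
    have D: "finite D" "card D \<le> m"
      using V card_image_le[of V "\<lambda>v. \<sigma> v div l"] by (auto simp: D_def)
    define \<sigma>' where "\<sigma>' v = (if v \<in> V then block_map l (rank D) (\<sigma> v) else 0)" for v
    have "\<sigma>' v < l * m" for v
    proof (cases "v \<in> V")
      case True
      then have "rank D (\<sigma> v div l) < m" using rank_less[OF D(1), of "\<sigma> v div l"] D(2) by (auto simp: D_def)
      then show ?thesis using True l by (simp add: \<sigma>'_def block_map_less)
    qed (use l m in \<open>auto simp: \<sigma>'_def\<close>)
    moreover have "same_type l (map \<sigma> vs) (map \<sigma>' vs)" if "set vs \<subseteq> V" for vs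
    proof -
      have "same_type l (map \<sigma> vs) (map (block_map l (rank D)) (map \<sigma> vs))"
        by (rule same_type_block_map[OF l strict_mono_on_rank[OF D(1)]]) (use that in \<open>auto simp: D_def\<close>)
      also have "map (block_map l (rank D)) (map \<sigma> vs) = map \<sigma>' vs"
        using that by (auto simp: \<sigma>'_def)
      finally show ?thesis .
    qed
    ultimately show ?thesis by blast
  qed
  have holds: "holds R' \<sigma> q \<longleftrightarrow> holds R \<sigma>' q"
    if "\<And>v. \<sigma> v < n" "\<And>v. \<sigma>' v < l * m" "\<And>vs. set vs \<subseteq> qf_vars q \<Longrightarrow> same_type l (map \<sigma> vs) (map \<sigma>' vs)"
    for \<sigma> \<sigma>' q
  proof (rule holds_transfer)
    show "R' i (map \<sigma> vs) \<longleftrightarrow> R i (map \<sigma>' vs)" if "set vs \<subseteq> qf_vars q" for i vs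
      by (rule R') (use \<open>\<And>v. \<sigma> v < n\<close> \<open>\<And>v. \<sigma>' v < l * m\<close> that \<open>\<And>vs. _ \<Longrightarrow> same_type l (map \<sigma> vs) (map \<sigma>' vs)\<close> in auto)
    show "\<sigma> a = \<sigma> b \<longleftrightarrow> \<sigma>' a = \<sigma>' b" if "a \<in> qf_vars q" "b \<in> qf_vars q" for a b
      using \<open>\<And>vs. _ \<Longrightarrow> same_type l (map \<sigma> vs) (map \<sigma>' vs)\<close>[of "[a, b]"] that by (auto dest: same_type_pair_eq)
  qed
  show "\<exists>R. is_model L Ax n R \<and> (\<forall>x<n. \<forall>y<n. Q x y \<longrightarrow> interp_edge R \<phi> x y)"
  proof (intro exI[of _ R'] conjI allI impI)
    show "is_model L Ax n R'"
      unfolding is_model_def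
    proof (intro conjI allI impI ballI)
      show "is_struct L n R'" by (auto simp: is_struct_def R'_def)
      fix \<sigma> :: "nat \<Rightarrow> nat" and ax assume \<sigma>: "\<forall>v. \<sigma> v < n" and ax: "ax \<in> set Ax"
      obtain \<sigma>' where \<sigma>': "\<forall>v. \<sigma>' v < l * m" "\<forall>vs. set vs \<subseteq> {..<m} \<longrightarrow> same_type l (map \<sigma> vs) (map \<sigma>' vs)"
        using transfer[of "{..<m}" \<sigma>] by auto
      have "holds R \<sigma>' ax" using model ax \<sigma>'(1) by (auto simp: is_model_def)
      moreover have "holds R' \<sigma> ax \<longleftrightarrow> holds R \<sigma>' ax"
        by (rule holds) (use \<sigma> \<sigma>' vars[OF ax] in auto)
      ultimately show "holds R' \<sigma> ax" by simp
    qed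
    fix x y assume xy: "x < n" "y < n" "Q x y"
    have "finite {0::nat, 1}" "card {0::nat, 1} \<le> m" using m by simp_all
    from transfer[OF this, of "\<lambda>v. if v = 0 then x else y"] obtain \<sigma>' :: "nat \<Rightarrow> nat" where \<sigma>':
        "\<forall>v. \<sigma>' v < l * m"
        "\<forall>vs. set vs \<subseteq> {0, 1} \<longrightarrow> same_type l (map (\<lambda>v. if v = 0 then x else y) vs) (map \<sigma>' vs)"
      by blast
    \<comment> \<open>\<open>interp_edge\<close> assigns the second vertex to every variable other
      than 0, whereas \<open>\<sigma>'\<close> is controlled on 0 and 1 only; \<open>\<tau>\<close>
      collapses the variables in the same way.\<close>
    define \<tau> where "\<tau> v = (if v = 0 then \<sigma>' 0 else \<sigma>' 1)" for v :: nat
    have \<tau>: "same_type l (map (\<lambda>v. if v = 0 then x else y) vs) (map \<tau> vs)" for vs :: "nat list"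
    proof -
      let ?c = "\<lambda>v::nat. if v = 0 then 0 else 1::nat"
      have "same_type l (map (\<lambda>v. if v = 0 then x else y) (map ?c vs)) (map \<sigma>' (map ?c vs))"
        by (rule \<sigma>'(2)[rule_format]) auto
      moreover have "map (\<lambda>v. if v = 0 then x else y) (map ?c vs) = map (\<lambda>v. if v = 0 then x else y) vs"
        "map \<sigma>' (map ?c vs) = map \<tau> vs" by (auto simp: \<tau>_def)
      ultimately show ?thesis by (simp only:)
    qed
    have "Q (\<sigma>' 0) (\<sigma>' 1)" using Q[OF _ xy(3)] \<tau>[of "[0, 1]"] by (simp add: \<tau>_def)
    then have "interp_edge R \<phi> (\<sigma>' 0) (\<sigma>' 1)" using edges \<sigma>'(1) by blast
    then have "holds R \<tau> \<phi>" unfolding interp_edge_def \<tau>_def[abs_def] .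
    moreover have "holds R' (\<lambda>v. if v = 0 then x else y) \<phi> \<longleftrightarrow> holds R \<tau> \<phi>"
      by (rule holds) (use xy \<sigma>'(1) \<tau> in \<open>auto simp: \<tau>_def\<close>)
    ultimately show "interp_edge R' \<phi> x y" by (simp add: interp_edge_def)
  qed
qed

text \<open>Colour an \<open>m\<close>-set of blocks by the structure that it carries. On a monochromatic set \<open>H\<close> of
  \<open>2 * m\<close> blocks the first \<open>m\<close> blocks carry a homogeneous structure; the last \<open>m\<close> blocks serve to
  extend the blocks of a tuple at the upper end to an \<open>m\<close>-set.\<close>

lemma realizable_imp_certificate:
  assumes real: "realizable L Ax \<phi> Q" and l: "0 < l"
    and arity: "\<And>i. i < length L \<Longrightarrow> L ! i \<le> m"
    and Q: "\<And>x y x' y'. same_type l [x, y] [x', y'] \<Longrightarrow> Q x y \<Longrightarrow> Q x' y'"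
  shows "\<exists>R. certificate L Ax \<phi> Q l m R"
proof -
  define F where "F = Sigma {..<length L} (\<lambda>i. {xs. set xs \<subseteq> {..<l * m} \<and> length xs = L ! i})"
  have "finite F" unfolding F_def by (rule finite_SigmaI) (auto intro: finite_lists_length_eq)
  then have "finite (Pow F)" by simp
  from ex_bij_betw_finite_nat[OF this] obtain c where c: "bij_betw c (Pow F) {0..<card (Pow F)}" ..
  obtain N where N: "partn_lst {..<N::nat} (replicate (card (Pow F)) (2 * m)) m"
    using ramsey_full ..
  obtain R where R: "is_model L Ax (l * N) R"
    and edges: "\<And>x y. x < l * N \<Longrightarrow> y < l * N \<Longrightarrow> Q x y \<Longrightarrow> interp_edge R \<phi> x y"
    using real[unfolded realizable_def, rule_format, of "l * N"] by blast
  \<comment> \<open>\<open>emb A\<close> carries block \<open>b < m\<close> to the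
    \<open>b\<close>-th smallest element of an \<open>m\<close>-set \<open>A\<close>, so
    \<open>str A\<close> is the structure on the blocks of \<open>A\<close> in coordinates
    independent of \<open>A\<close>, and thus one of finitely many colours.\<close>
  define emb where "emb A = block_map l (\<lambda>b. sorted_list_of_set A ! b)" for A
  define str where "str A = {(i, xs) \<in> F. R i (map (emb A) xs)}" for A
  have str: "str A \<in> Pow F" for A by (auto simp: str_def)
  have "c (str A) \<in> {..<card (Pow F)}" for A
    using bij_betwE[OF c, rule_format, OF str] by simp
  then have "(\<lambda>A. c (str A)) \<in> nsets {..<N} m \<rightarrow> {..<card (Pow F)}" by (rule Pi_I)
  from partn_lstE[OF N this length_replicate] obtain i0 H
    where i0: "i0 < length (replicate (card (Pow F)) (2 * m))"
    and H: "H \<in> nsets {..<N} (replicate (card (Pow F)) (2 * m) ! i0)"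
    and mono: "(\<lambda>A. c (str A)) ` nsets H m \<subseteq> {i0}" .
  have H': "finite H" "card H = 2 * m" "H \<subseteq> {..<N}" using H i0 by (auto simp: nsets_def)
  have str_eq: "str A = str B" if "A \<in> nsets H m" "B \<in> nsets H m" for A B
  proof -
    have "c (str A) = c (str B)" using mono that by blast
    then show ?thesis by (rule inj_onD[OF bij_betw_imp_inj_on[OF c] _ str str])
  qed
  define hs where "hs = sorted_list_of_set H"
  have hs: "length hs = 2 * m" "set hs = H" "sorted_wrt (<) hs"
    using H' by (auto simp: hs_def)
  have hs_mono2: "strict_mono_on {..<2 * m} ((!) hs)"
    by (rule strict_mono_onI) (use hs in \<open>auto intro!: sorted_wrt_nth_less[of "(<)" hs]\<close>)
  have hs_less: "hs ! a < hs ! b \<longleftrightarrow> a < b" if "a < 2 * m" "b < 2 * m" for a b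
    using strict_mono_on_less[OF hs_mono2] that by simp
  have hs_inj: "inj_on ((!) hs) {..<2 * m}"
    using hs_mono2 by (rule strict_mono_on_imp_inj_on)
  have hs_mono: "strict_mono_on {..<m} ((!) hs)"
    by (rule strict_mono_onI) (auto simp: hs_less)
  have hs_in: "hs ! b \<in> H" if "b < 2 * m" for b using that hs nth_mem by metis
  define e where "e = block_map l ((!) hs)"
  have div: "x div l < m" if "x < l * m" for x
    using that l by (simp add: less_mult_imp_div_less mult.commute)
  have e_less: "e x < l * N" if "x < l * m" for x
    unfolding e_def using div[OF that] hs_in[of "x div l"] H'(3) by (intro block_map_less l) auto
  have e_inj: "inj_on e {..<l * m}"
    unfolding e_def by (rule inj_on_block_map[OF l strict_mono_on_imp_inj_on[OF hs_mono]]) (use div in auto)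
  have e_type: "same_type l xs (map e xs)" if "set xs \<subseteq> {..<l * m}" for xs
    unfolding e_def by (rule same_type_block_map[OF l hs_mono]) (use that div in auto)
  define R' where "R' = pullback L (l * m) e R"
  \<comment> \<open>Truth of \<open>R' i xs\<close> is read off from a colour after replacing the
    blocks of \<open>xs\<close> by their ranks. Any \<open>m\<close>-subset \<open>A\<close> of
    \<open>H\<close> may be consulted, since all of them carry the same structure.\<close>
  have canon: "R' i xs \<longleftrightarrow> (i, map (block_map l (rank ((\<lambda>x. x div l) ` set xs))) xs) \<in> str A"
    if xs: "set xs \<subseteq> {..<l * m}" "length xs = L ! i" "i < length L" and A: "A \<in> nsets H m" for i xs A
  proof -
    let ?D = "(\<lambda>x. x div l) ` set xs"
    let ?zs = "map (block_map l (rank ?D)) xs"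
    have D: "?D \<subseteq> {..<m}" "finite ?D" using xs(1) div by auto
    have "card ?D \<le> length xs" using card_image_le[of "set xs" "\<lambda>x. x div l"] card_length[of xs] by simp
    then have Dm: "card ?D \<le> m" using xs arity[of i] by simp
    \<comment> \<open>The \<open>m - card ?D\<close> padding indices exceed every element of
      \<open>?D\<close>, so the ranks of the elements of \<open>?D\<close> do not change.\<close>
    define I where "I = ?D \<union> {m..<2 * m - card ?D}"
    have "?D \<inter> {m..<2 * m - card ?D} = {}" using D(1) by auto
    then have I: "card I = m" "I \<subseteq> {..<2 * m}" "finite I"
      unfolding I_def using D Dm by (auto simp: card_Un_disjoint)
    define B where "B = (!) hs ` I"
    have "card B = m" unfolding B_def using card_image[OF inj_on_subset[OF hs_inj I(2)]] I(1) by simp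
    then have B: "B \<in> nsets H m" using I hs_in by (auto simp: nsets_def B_def)
    have nth: "sorted_list_of_set B ! rank ?D d = hs ! d" if d: "d \<in> ?D" for d
    proof -
      have dm: "d < m" using d D by auto
      have "{x\<in>B. x < hs ! d} = (!) hs ` {x\<in>?D. x < d}"
      proof
        show "{x\<in>B. x < hs ! d} \<subseteq> (!) hs ` {x\<in>?D. x < d}"
        proof clarify
          fix x assume "x \<in> B" "x < hs ! d"
          then obtain b where b: "b \<in> I" "x = hs ! b" by (auto simp: B_def)
          then have "b < d" using \<open>x < hs ! d\<close> hs_less[of b d] I(2) dm by auto
          then have "b \<in> ?D" using b(1) dm by (auto simp: I_def)
          then show "x \<in> (!) hs ` {x\<in>?D. x < d}" using b(2) \<open>b < d\<close> by blast
        qed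
        show "(!) hs ` {x\<in>?D. x < d} \<subseteq> {x\<in>B. x < hs ! d}"
        proof (rule image_subsetI)
          fix b assume b: "b \<in> {x\<in>?D. x < d}"
          then have "hs ! b \<in> B" by (auto simp: B_def I_def)
          moreover have "hs ! b < hs ! d" using b dm hs_less[of b d] by auto
          ultimately show "hs ! b \<in> {x\<in>B. x < hs ! d}" by simp
        qed
      qed
      moreover have "inj_on ((!) hs) {x\<in>?D. x < d}"
        by (rule inj_on_subset[OF hs_inj]) (use dm in auto)
      ultimately have "rank B (hs ! d) = rank ?D d" by (simp add: rank_def card_image)
      moreover have "hs ! d \<in> B" using d by (auto simp: B_def I_def)
      moreover have "finite B" using I by (simp add: B_def)
      ultimately show ?thesis using nth_rank[of B "hs ! d"] by simp
    qed
    have mapeq: "map (emb B) ?zs = map e xs"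
    proof -
      have "emb B (block_map l (rank ?D) x) = e x" if "x \<in> set xs" for x
        unfolding emb_def e_def using nth[of "x div l"] that
        by (simp add: block_map_def[of l "(!) _"] block_map_div_mod l)
      then show ?thesis by simp
    qed
    have "set ?zs \<subseteq> {..<l * m}"
    proof -
      have "block_map l (rank ?D) x < l * m" if "x \<in> set xs" for x
        using rank_less[OF D(2), of "x div l"] Dm that by (intro block_map_less l) auto
      then show ?thesis by auto
    qed
    then have "(i, ?zs) \<in> F" using xs by (simp add: F_def)
    then have "(i, ?zs) \<in> str B \<longleftrightarrow> R i (map e xs)"
      unfolding str_def by (simp only: mem_Collect_eq prod.case mapeq simp_thms)
    moreover have "R' i xs \<longleftrightarrow> R i (map e xs)"
      using xs by (simp add: R'_def pullback_def)
    ultimately show ?thesis using str_eq[OF A B] by simp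
  qed
  have "set (take m hs) \<subseteq> H" "card (set (take m hs)) = m"
    using hs set_take_subset[of m hs] by (auto simp: distinct_card strict_sorted_iff)
  then have A: "set (take m hs) \<in> nsets H m" by (simp add: nsets_def)
  have "homogeneous l (l * m) R'"
    unfolding homogeneous_def
  proof (intro allI impI)
    fix i xs ys assume xs: "set xs \<subseteq> {..<l * m}" and ys: "set ys \<subseteq> {..<l * m}" and st: "same_type l xs ys"
    have len: "length xs = length ys" using st by (simp add: same_type_def)
    show "R' i xs \<longleftrightarrow> R' i ys"
    proof (cases "i < length L \<and> length xs = L ! i")
      case True
      \<comment> \<open>Equal parts and equal ranks: tuples of one type compress to the same list,
        for which \<open>canon\<close> gives a single answer.\<close>
      have "map (block_map l (rank ((\<lambda>x. x div l) ` set xs))) xs = map (block_map l (rank ((\<lambda>x. x div l) ` set ys))) ys"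
        using st rank_same_type[OF st] by (intro nth_equalityI) (auto simp: block_map_def same_type_def)
      then show ?thesis using canon[OF xs _ _ A, of i] canon[OF ys _ _ A, of i] True len by simp
    qed (auto simp: R'_def pullback_def len)
  qed
  moreover have "is_model L Ax (l * m) R'"
    unfolding R'_def by (rule is_model_pullback[OF R e_inj]) (use e_less in auto)
  moreover have "interp_edge R' \<phi> x y" if "x < l * m" "y < l * m" "Q x y" for x y
  proof -
    have "Q (e x) (e y)" using Q[OF _ that(3)] e_type[of "[x, y]"] that by simp
    then show ?thesis
      unfolding R'_def using interp_edge_pullback[OF R e_inj that(1,2)] edges e_less that by simp
  qed
  ultimately show ?thesis by (auto simp: certificate_def)
qed

section \<open>The chromatic number and the limit density\<close>

text \<open>As \<open>x mod 0 = x\<close>, the relation \<open>parts 0\<close> asks for a complete graph, and its realizability means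
  that \<open>chi\<close> is infinite.\<close>

definition parts :: "nat \<Rightarrow> nat \<Rightarrow> nat \<Rightarrow> bool" where
  "parts k x y \<longleftrightarrow> x mod k \<noteq> y mod k"

lemma parts_0: "parts 0 x y \<longleftrightarrow> x \<noteq> y"
  by (simp add: parts_def)

text \<open>For \<open>k = 0\<close> types are taken with one part, so every vertex is its own block
  and the order type decides equality. For \<open>k > 0\<close> the residues belong to the
  type.\<close>

lemma parts_same_type:
  assumes "same_type (if k = 0 then 1 else k) [x, y] [x', y']" "parts k x y"
  shows "parts k x' y'"
proof (cases "k = 0")
  case True
  with assms(2) have "x \<noteq> y" by (simp add: parts_def)
  then have "x' \<noteq> y'" using same_type_pair_eq[OF assms(1)] by blast
  with True show ?thesis by (simp add: parts_def)
next
  case False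
  then have "x mod k = x' mod k" "y mod k = y' mod k" using same_type_pair_mod[OF assms(1)] by simp_all
  with assms(2) show ?thesis by (simp add: parts_def)
qed

section \<open>Realizability and the value of \<open>chi\<close>\<close>

lemma realizable_mono:
  assumes real: "realizable L Ax \<phi> Q" and g: "strict_mono g" and Q: "\<And>x y. Q' x y \<Longrightarrow> Q (g x) (g y)"
  shows "realizable L Ax \<phi> Q'"
  unfolding realizable_def
proof
  fix n
  \<comment> \<open>Size \<open>g n\<close> suffices, as \<open>g x < g n\<close> for all
    \<open>x < n\<close>.\<close>
  obtain R where R: "is_model L Ax (g n) R"
    and edges: "\<forall>x<g n. \<forall>y<g n. Q x y \<longrightarrow> interp_edge R \<phi> x y"
    using real[unfolded realizable_def, rule_format, of "g n"] by blast
  have less: "g x < g n" if "x < n" for x using strict_monoD[OF g that] .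
  have inj: "inj_on g {..<n}" by (rule inj_on_subset[OF strict_mono_imp_inj_on[OF g] subset_UNIV])
  have "is_model L Ax n (pullback L n g R)"
    by (rule is_model_pullback[OF R inj]) (auto intro: less)
  moreover have "interp_edge (pullback L n g R) \<phi> x y" if "x < n" "y < n" "Q' x y" for x y
  proof -
    have "interp_edge R \<phi> (g x) (g y)" using edges less[OF that(1)] less[OF that(2)] Q[OF that(3)] by simp
    then show ?thesis using interp_edge_pullback[OF R inj that(1,2)] by simp
  qed
  ultimately show "\<exists>R. is_model L Ax n R \<and> (\<forall>x<n. \<forall>y<n. Q' x y \<longrightarrow> interp_edge R \<phi> x y)"
    by (intro exI[of _ "pullback L n g R"] conjI allI impI) simp_all
qed

text \<open>The map \<open>x + x div Suc l\<close> skips the last of the \<open>l + 2\<close> parts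
  in each block.\<close>

lemma realizable_parts_Suc:
  assumes "realizable L Ax \<phi> (parts (Suc (Suc l)))"
  shows "realizable L Ax \<phi> (parts (Suc l))"
proof (rule realizable_mono[OF assms])
  let ?g = "\<lambda>x. x + x div Suc l"
  show "strict_mono ?g"
  proof (rule strict_monoI)
    fix x y :: nat assume "x < y"
    then show "?g x < ?g y" using div_le_mono[of x y "Suc l"] by simp
  qed
  have eq: "?g x mod Suc (Suc l) = x mod Suc l" for x
  proof -
    have "?g x = x mod Suc l + x div Suc l * Suc (Suc l)"
      using div_mult_mod_eq[of x "Suc l"] by (simp add: algebra_simps)
    moreover have "x mod Suc l < Suc (Suc l)" by (rule less_SucI) simp
    ultimately show ?thesis by (simp only: mod_mult_self1 mod_less)
  qed
  show "parts (Suc (Suc l)) (?g x) (?g y)" if "parts (Suc l) x y" for x y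
    using that unfolding parts_def eq .
qed

lemma realizable_parts_le:
  "l \<le> l' \<Longrightarrow> realizable L Ax \<phi> (parts (Suc l')) \<Longrightarrow> realizable L Ax \<phi> (parts (Suc l))"
  by (induction l' rule: dec_induct) (auto dest: realizable_parts_Suc)

lemma realizable_imp: "realizable L Ax \<phi> Q \<Longrightarrow> (\<And>x y. Q' x y \<Longrightarrow> Q x y) \<Longrightarrow> realizable L Ax \<phi> Q'"
  using realizable_mono[of L Ax \<phi> Q "\<lambda>x. x" Q'] by (simp add: strict_mono_def)

text \<open>The vertices below \<open>n\<close> have distinct residues modulo \<open>n + 1\<close>,
  so for each size one suitable number of parts already gives a complete graph.\<close>

lemma realizable_complete_iff:
  "realizable L Ax \<phi> (parts 0) \<longleftrightarrow> (\<forall>l. realizable L Ax \<phi> (parts (Suc l)))"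
proof
  assume real: "realizable L Ax \<phi> (parts 0)"
  have "realizable L Ax \<phi> (parts (Suc l))" for l
    using real by (rule realizable_imp) (auto simp: parts_def)
  then show "\<forall>l. realizable L Ax \<phi> (parts (Suc l))" ..
next
  assume all: "\<forall>l. realizable L Ax \<phi> (parts (Suc l))"
  show "realizable L Ax \<phi> (parts 0)"
    unfolding realizable_def
  proof
    fix n
    obtain R where "is_model L Ax n R" "\<forall>x<n. \<forall>y<n. parts (Suc n) x y \<longrightarrow> interp_edge R \<phi> x y"
      using all unfolding realizable_def by blast
    then show "\<exists>R. is_model L Ax n R \<and> (\<forall>x<n. \<forall>y<n. parts 0 x y \<longrightarrow> interp_edge R \<phi> x y)"
      by (intro exI[of _ R]) (auto simp: parts_def)
  qed
qed

lemma subgraph_turan_pullback: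
  assumes R: "is_model L Ax n R" and sub: "subgraph s (turan s l) n (igraph R \<phi>)"
  shows "\<exists>R. is_model L Ax s R \<and> (\<forall>x<s. \<forall>y<s. parts l x y \<longrightarrow> interp_edge R \<phi> x y)"
proof -
  obtain f where f: "inj_on f {..<s}" "f ` {..<s} \<subseteq> {..<n}"
    "\<And>x y. x < s \<Longrightarrow> y < s \<Longrightarrow> turan s l x y \<Longrightarrow> igraph R \<phi> (f x) (f y)"
    using sub by (auto simp: subgraph_def)
  have "interp_edge (pullback L s f R) \<phi> x y" if "x < s" "y < s" "parts l x y" for x y
    using interp_edge_pullback[OF R f(1) that(1,2)] f(3)[of x y] that
    by (simp add: turan_def parts_def igraph_def)
  then show ?thesis using is_model_pullback[OF R f(1,2)] by blast
qed

lemma subgraph_turan_igraph: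
  assumes "\<forall>x<n. \<forall>y<n. parts l x y \<longrightarrow> interp_edge R \<phi> x y"
  shows "subgraph n (turan n l) n (igraph R \<phi>)"
  unfolding subgraph_def using assms
  by (intro exI[of _ id]) (auto simp: turan_def parts_def igraph_def)

text \<open>The condition in \<open>chi\<close> allows any embedding of the Turan graph; pulling the
  model back along it makes the embedding the identity.\<close>

lemma realizable_parts_iff:
  "realizable L Ax \<phi> (parts l) \<longleftrightarrow>
    (\<forall>n. \<exists>R. is_model L Ax n R \<and> subgraph n (turan n l) n (igraph R \<phi>))"
  unfolding realizable_def
proof (intro iffI allI)
  fix n
  assume "\<forall>n. \<exists>R. is_model L Ax n R \<and> (\<forall>x<n. \<forall>y<n. parts l x y \<longrightarrow> interp_edge R \<phi> x y)"
  then obtain R where "is_model L Ax n R" "\<forall>x<n. \<forall>y<n. parts l x y \<longrightarrow> interp_edge R \<phi> x y" by blast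
  then show "\<exists>R. is_model L Ax n R \<and> subgraph n (turan n l) n (igraph R \<phi>)"
    using subgraph_turan_igraph by blast
next
  fix n
  assume "\<forall>n. \<exists>R. is_model L Ax n R \<and> subgraph n (turan n l) n (igraph R \<phi>)"
  then obtain R where "is_model L Ax n R" "subgraph n (turan n l) n (igraph R \<phi>)" by blast
  then show "\<exists>R. is_model L Ax n R \<and> (\<forall>x<n. \<forall>y<n. parts l x y \<longrightarrow> interp_edge R \<phi> x y)"
    by (rule subgraph_turan_pullback)
qed

lemma chi_eq:
  "chi L Ax \<phi> = Sup ({enat l | l. 0 < l \<and> realizable L Ax \<phi> (parts l)} \<union> {0}) + 1"
  unfolding chi_def realizable_parts_iff ..

lemma chi_infinite:
  assumes "realizable L Ax \<phi> (parts 0)"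
  shows "chi L Ax \<phi> = \<infinity>"
proof -
  let ?A = "{enat l | l. 0 < l \<and> realizable L Ax \<phi> (parts l)} \<union> {0}"
  have bound: "enat n \<le> Sup ?A" for n
  proof -
    have "enat (Suc n) \<in> ?A" using assms realizable_complete_iff by blast
    then have "enat (Suc n) \<le> Sup ?A" by (rule Sup_upper)
    then show ?thesis by (rule order_trans[rotated]) simp
  qed
  have "Sup ?A = \<infinity>"
  proof (cases "Sup ?A")
    case (enat m)
    with bound[of "Suc m"] show ?thesis by simp
  qed
  then show ?thesis by (simp add: chi_eq)
qed

text \<open>Realizability passes to every smaller positive number of parts, so failure at
  \<open>Suc l\<close> rules out all larger numbers. For \<open>l = 0\<close> the supremum is
  attained by the extra element 0.\<close>

lemma chi_finite:
  assumes "\<not> realizable L Ax \<phi> (parts (Suc l))" "0 < l \<Longrightarrow> realizable L Ax \<phi> (parts l)"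
  shows "chi L Ax \<phi> = enat (Suc l)"
proof -
  let ?A = "{enat l | l. 0 < l \<and> realizable L Ax \<phi> (parts l)} \<union> {0}"
  have "Sup ?A = enat l"
  proof (rule antisym)
    show "Sup ?A \<le> enat l"
    proof (rule Sup_least)
      fix x assume x: "x \<in> ?A"
      show "x \<le> enat l"
      proof (cases "x = 0")
        case False
        then obtain j where j: "x = enat j" "0 < j" "realizable L Ax \<phi> (parts j)" using x by auto
        have "\<not> l < j"
        proof
          assume "l < j"
          then obtain j' where "j = Suc j'" "l \<le> j'" by (cases j) auto
          with j(3) assms(1) realizable_parts_le show False by blast
        qed
        with j show ?thesis by simp
      qed simp
    qed
    have "enat l \<in> ?A" using assms(2) by (cases l) (auto simp: zero_enat_def)
    then show "enat l \<le> Sup ?A" by (rule Sup_upper)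
  qed
  then show ?thesis by (simp add: chi_eq one_enat_def)
qed

section \<open>Limits of \<open>pi_seq\<close>\<close>

lemma clique_density_le_1: "clique_density t n G \<le> 1"
proof -
  have "cliques n G t \<subseteq> {A. A \<subseteq> {..<n} \<and> card A = t}" by (auto simp: cliques_def)
  then have "card (cliques n G t) \<le> card {A. A \<subseteq> {..<n} \<and> card A = t}"
    by (rule card_mono[rotated]) simp
  then have "card (cliques n G t) \<le> n choose t" by (simp add: n_subsets)
  then show ?thesis
    by (cases "n choose t = 0") (simp_all add: clique_density_eq divide_le_eq_1_pos del: binomial_eq_0_iff)
qed

lemma pi_seq_upper:
  "(\<And>R. is_model L Ax n R \<Longrightarrow> clique_density t n (igraph R \<phi>) \<le> c) \<Longrightarrow> pi_seq L Ax \<phi> t n \<le> ereal c"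
  unfolding pi_seq_def by (rule Sup_least) auto

lemma pi_seq_lower:
  "is_model L Ax n R \<Longrightarrow> c \<le> clique_density t n (igraph R \<phi>) \<Longrightarrow> ereal c \<le> pi_seq L Ax \<phi> t n"
  unfolding pi_seq_def by (rule Sup_upper2) auto

lemma pi_seq_complete:
  assumes "realizable L Ax \<phi> (parts 0)"
  shows "pi_seq L Ax \<phi> t \<longlonglongrightarrow> 1"
proof (rule tendsto_eventually, rule eventually_sequentiallyI)
  fix n assume n: "t \<le> n"
  obtain R where R: "is_model L Ax n R" "\<forall>x<n. \<forall>y<n. x \<noteq> y \<longrightarrow> interp_edge R \<phi> x y"
    using assms unfolding realizable_def parts_0 by blast
  then have "cliques n (igraph R \<phi>) t = {A. A \<subseteq> {..<n} \<and> card A = t}"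
    by (auto simp: cliques_def clique_def igraph_def)
  then have "clique_density t n (igraph R \<phi>) = 1"
    using n by (simp add: clique_density_eq n_subsets)
  then have "ereal 1 \<le> pi_seq L Ax \<phi> t n" by (intro pi_seq_lower[OF R(1)]) simp
  moreover have "pi_seq L Ax \<phi> t n \<le> ereal 1" by (rule pi_seq_upper) (rule clique_density_le_1)
  ultimately show "pi_seq L Ax \<phi> t n = 1" by (simp add: one_ereal_def)
qed

text \<open>\<open>parts 1\<close> has no pairs, so its failure means that some size has no model.
  Closure under substructures then excludes all larger sizes, and the supremum of the empty set is
  minus infinity.\<close>

lemma pi_seq_no_models:
  assumes "\<not> realizable L Ax \<phi> (parts 1)"
  shows "pi_seq L Ax \<phi> t \<longlonglongrightarrow> - \<infinity>"
proof -
  obtain n0 where n0: "\<And>R. \<not> is_model L Ax n0 R"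
    using assms by (auto simp: realizable_def parts_def)
  show ?thesis
  proof (rule tendsto_eventually, rule eventually_sequentiallyI)
    fix n assume "n0 \<le> n"
    then have "\<not> is_model L Ax n R" for R
      using is_model_pullback[of L Ax n R id n0] n0 by auto
    then show "pi_seq L Ax \<phi> t n = - \<infinity>" by (simp add: pi_seq_def bot_ereal_def)
  qed
qed

text \<open>Below, realizability supplies a model containing the Turan graph at every size. Above,
  its failure for \<open>Suc l\<close> parts supplies one \<open>s\<close> such that the graph of
  every model, of whatever size, omits the \<open>Suc l\<close>-partite Turan graph on
  \<open>s\<close> vertices.\<close>

lemma pi_seq_limit:
  assumes l: "0 < l" and real: "realizable L Ax \<phi> (parts l)" and nreal: "\<not> realizable L Ax \<phi> (parts (Suc l))"
  shows "pi_seq L Ax \<phi> t \<longlonglongrightarrow> ereal (\<Prod>j<t. 1 - real j / real l)" (is "_ \<longlonglongrightarrow> ereal ?c")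
proof (rule order_tendstoI)
  fix a assume a: "a < ereal ?c"
  let ?f = "\<lambda>n. real ((l choose t) * (n div l) ^ t) / real (n choose t)"
  have lim: "(\<lambda>n. ereal (?f n)) \<longlonglongrightarrow> ereal ?c" by (rule tendsto_ereal[OF turan_clique_limit[OF l]])
  have le: "ereal (?f n) \<le> pi_seq L Ax \<phi> t n" for n
  proof -
    obtain R where R: "is_model L Ax n R" "\<forall>x<n. \<forall>y<n. parts l x y \<longrightarrow> interp_edge R \<phi> x y"
      using real[unfolded realizable_def, rule_format, of n] by blast
    have "(l choose t) * (n div l) ^ t \<le> card (cliques n (igraph R \<phi>) t)"
      using card_cliques_turan_ge[OF l] card_cliques_subgraph[OF subgraph_turan_igraph[OF R(2)]]
      by (rule order_trans)
    then have "?f n \<le> clique_density t n (igraph R \<phi>)"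
      unfolding clique_density_eq by (rule divide_right_mono[OF of_nat_mono]) simp
    then show ?thesis by (rule pi_seq_lower[OF R(1)])
  qed
  show "\<forall>\<^sub>F n in sequentially. a < pi_seq L Ax \<phi> t n"
    by (rule eventually_mono[OF order_tendstoD(1)[OF lim a]]) (rule less_le_trans[OF _ le])
next
  fix a assume a: "ereal ?c < a"
  obtain b where b: "ereal ?c < ereal b" "ereal b < a" using ereal_dense2[OF a] by blast
  obtain s where s: "\<not> (\<exists>R. is_model L Ax s R \<and> (\<forall>x<s. \<forall>y<s. parts (Suc l) x y \<longrightarrow> interp_edge R \<phi> x y))"
    using nreal[unfolded realizable_def not_all] ..
  have "0 < b - ?c" using b(1) by simp
  from erdos_stone_upper[OF l this, of s t] show "\<forall>\<^sub>F n in sequentially. pi_seq L Ax \<phi> t n < a"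
  proof (rule eventually_mono)
    fix n
    assume n: "\<forall>G. \<not> subgraph s (turan s (Suc l)) n G \<longrightarrow> clique_density t n G \<le> ?c + (b - ?c)"
    have "pi_seq L Ax \<phi> t n \<le> ereal b"
    proof (rule pi_seq_upper)
      fix R assume R: "is_model L Ax n R"
      have "\<not> subgraph s (turan s (Suc l)) n (igraph R \<phi>)"
        using subgraph_turan_pullback[OF R] s by (rule contrapos_nn[rotated])
      from n[rule_format, OF this] show "clique_density t n (igraph R \<phi>) \<le> b" by simp
    qed
    then show "pi_seq L Ax \<phi> t n < a" using b(2) by (rule le_less_trans)
  qed
qed

text \<open>Truncated subtraction is harmless: once \<open>n < t\<close>, both products contain the
  factor \<open>j = n\<close>, which is 0.\<close>

lemma prod_nat_diff: "real (\<Prod>j<t. n - j) = (\<Prod>j<t. real n - real j)"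
proof (cases "t \<le> n")
  case True
  then show ?thesis unfolding of_nat_prod by (intro prod.cong) auto
next
  case False
  then have n: "n \<in> {..<t}" by simp
  have "(\<Prod>j<t. real (n - j)) = 0"
    by (rule prod_zero[OF finite_lessThan bexI[OF _ n]]) simp
  moreover have "(\<Prod>j<t. real n - real j) = 0"
    by (rule prod_zero[OF finite_lessThan bexI[OF _ n]]) simp
  ultimately show ?thesis unfolding of_nat_prod by (simp only:)
qed

lemma prod_one_minus: "0 < n \<Longrightarrow> (\<Prod>j<t. 1 - real j / real n) = real (\<Prod>j<t. n - j) / real n ^ t"
proof -
  assume "0 < n"
  then have "(\<Prod>j<t. 1 - real j / real n) = (\<Prod>j<t. (real n - real j) / real n)"
    by (simp add: field_simps)
  also have "\<dots> = real (\<Prod>j<t. n - j) / real n ^ t" unfolding prod_nat_diff by (simp add: prod_dividef)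
  finally show ?thesis .
qed

section \<open>The algorithm\<close>

definition facts :: "nat list \<Rightarrow> nat \<Rightarrow> (nat \<times> nat list) list" where
  "facts L N = concat (map (\<lambda>i. map (\<lambda>xs. (i, xs)) (List.n_lists (hd (drop i L)) [0..<N])) [0..<length L])"

lemma set_facts: "set (facts L N) = {(i, xs). i < length L \<and> length xs = L ! i \<and> set xs \<subseteq> {..<N}}"
  by (auto simp: facts_def set_n_lists hd_drop_conv_nth atLeast0LessThan)

definition same_type_check :: "nat \<Rightarrow> nat list \<Rightarrow> nat list \<Rightarrow> bool" where
  "same_type_check l xs ys \<longleftrightarrow> length xs = length ys \<and>
    (\<forall>a\<in>set [0..<length xs]. lookup xs a mod l = lookup ys a mod l \<and>
      (\<forall>b\<in>set [0..<length xs]. (lookup xs a div l < lookup xs b div l) = (lookup ys a div l < lookup ys b div l)))"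

lemma same_type_check: "same_type_check l xs ys \<longleftrightarrow> same_type l xs ys"
proof (cases "length xs = length ys")
  case True
  then show ?thesis
    unfolding same_type_check_def same_type_def set_upt Ball_def atLeastLessThan_iff
    by (simp add: lookup_nth cong: conj_cong imp_cong)
qed (simp add: same_type_check_def same_type_def)

definition certificate_check :: "nat \<Rightarrow> nat \<Rightarrow> nat \<Rightarrow> nat list \<Rightarrow> qf list \<Rightarrow> qf \<Rightarrow> bool" where
  "certificate_check k l m L Ax \<phi> \<longleftrightarrow> (\<exists>rel\<in>set (subseqs (facts L (l * m))).
    (\<forall>\<sigma>\<in>set (List.n_lists m [0..<l * m]). \<forall>ax\<in>set Ax. holds (\<lambda>i xs. (i, xs) \<in> set rel) (lookup \<sigma>) ax) \<and>
    (\<forall>p\<in>set (facts L (l * m)). \<forall>q\<in>set (facts L (l * m)). fst p = fst q \<longrightarrow>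
      same_type_check l (snd p) (snd q) \<longrightarrow> (p \<in> set rel) = (q \<in> set rel)) \<and>
    (\<forall>x\<in>set [0..<l * m]. \<forall>y\<in>set [0..<l * m]. x mod k \<noteq> y mod k \<longrightarrow>
      holds (\<lambda>i xs. (i, xs) \<in> set rel) (lookup [x, y]) \<phi>))"

text \<open>Structures are sets of possible facts, and every such set is that of some list in
  \<open>subseqs\<close>. Valuations matter only on variables below \<open>m\<close>, hence become
  lists of length \<open>m\<close>. Homogeneity need only be tested on facts, since tuples of one
  type have equal length and all those of a wrong length are false.\<close>

lemma certificate_check_iff:
  assumes vars: "\<And>ax. ax \<in> set Ax \<Longrightarrow> qf_vars ax \<subseteq> {..<m}" and \<phi>: "qf_vars \<phi> \<subseteq> {0, 1}" and pos: "0 < l" "0 < m"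
  shows "certificate_check k l m L Ax \<phi> \<longleftrightarrow> (\<exists>R. certificate L Ax \<phi> (parts k) l m R)"
proof -
  let ?N = "l * m"
  have N: "0 < ?N" using pos by simp
  have model: "is_model L Ax ?N (\<lambda>i xs. (i, xs) \<in> T) \<longleftrightarrow>
      (\<forall>\<sigma>\<in>set (List.n_lists m [0..<?N]). \<forall>ax\<in>set Ax. holds (\<lambda>i xs. (i, xs) \<in> T) (lookup \<sigma>) ax)"
    if T: "T \<subseteq> set (facts L ?N)" for T
  proof -
    have struct: "is_struct L ?N (\<lambda>i xs. (i, xs) \<in> T)"
      using T by (auto simp: is_struct_def set_facts)
    have "(\<forall>\<sigma>. (\<forall>v. \<sigma> v < ?N) \<longrightarrow> (\<forall>ax\<in>set Ax. holds (\<lambda>i xs. (i, xs) \<in> T) \<sigma> ax)) \<longleftrightarrow>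
      (\<forall>\<sigma>\<in>set (List.n_lists m [0..<?N]). \<forall>ax\<in>set Ax. holds (\<lambda>i xs. (i, xs) \<in> T) (lookup \<sigma>) ax)" (is "?l = ?r")
    proof
      assume l: ?l
      show ?r
      proof (intro ballI)
        fix \<sigma> ax assume \<sigma>: "\<sigma> \<in> set (List.n_lists m [0..<?N])" and ax: "ax \<in> set Ax"
        have len: "length \<sigma> = m" and sub: "set \<sigma> \<subseteq> {..<?N}" using \<sigma> by (auto simp: set_n_lists)
        \<comment> \<open>Past the end of the list the default value 0 is still a vertex, because
          \<open>0 < ?N\<close>.\<close>
        have "lookup \<sigma> v < ?N" for v
        proof (cases "v < length \<sigma>")
          case True
          then have "\<sigma> ! v \<in> {..<?N}" using sub nth_mem by blast
          with True show ?thesis by (simp add: lookup_nth)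
        qed (use N in \<open>simp add: lookup_def\<close>)
        with l ax show "holds (\<lambda>i xs. (i, xs) \<in> T) (lookup \<sigma>) ax" by blast
      qed
    next
      assume r: ?r
      show ?l
      proof (intro allI impI ballI)
        fix \<sigma> :: "nat \<Rightarrow> nat" and ax assume \<sigma>: "\<forall>v. \<sigma> v < ?N" and ax: "ax \<in> set Ax"
        have "map \<sigma> [0..<m] \<in> set (List.n_lists m [0..<?N])" using \<sigma> by (auto simp: set_n_lists)
        with r ax have "holds (\<lambda>i xs. (i, xs) \<in> T) (lookup (map \<sigma> [0..<m])) ax" by blast
        moreover have "holds (\<lambda>i xs. (i, xs) \<in> T) (lookup (map \<sigma> [0..<m])) ax \<longleftrightarrow> holds (\<lambda>i xs. (i, xs) \<in> T) \<sigma> ax"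
          by (rule holds_cong_vars) (use vars[OF ax] in \<open>auto simp: lookup_nth\<close>)
        ultimately show "holds (\<lambda>i xs. (i, xs) \<in> T) \<sigma> ax" by blast
      qed
    qed
    then show ?thesis using struct by (simp add: is_model_def)
  qed
  have hom: "homogeneous l ?N (\<lambda>i xs. (i, xs) \<in> T) \<longleftrightarrow>
      (\<forall>p\<in>set (facts L ?N). \<forall>q\<in>set (facts L ?N). fst p = fst q \<longrightarrow>
        same_type_check l (snd p) (snd q) \<longrightarrow> (p \<in> T) = (q \<in> T))" (is "?l = ?r")
    if T: "T \<subseteq> set (facts L ?N)" for T
  proof
    assume ?l
    then show ?r by (auto simp: homogeneous_def same_type_check set_facts)
  next
    assume r: ?r
    show ?l
      unfolding homogeneous_def
    proof (intro allI impI)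
      fix i xs ys assume xs: "set xs \<subseteq> {..<?N}" and ys: "set ys \<subseteq> {..<?N}" and st: "same_type l xs ys"
      show "(i, xs) \<in> T \<longleftrightarrow> (i, ys) \<in> T"
      proof (cases "i < length L \<and> length xs = L ! i")
        case True
        then have "(i, xs) \<in> set (facts L ?N)" "(i, ys) \<in> set (facts L ?N)"
          using xs ys st by (auto simp: set_facts same_type_def)
        then show ?thesis using r st by (fastforce simp: same_type_check)
      next
        case False
        then have "(i, xs) \<notin> set (facts L ?N)" "(i, ys) \<notin> set (facts L ?N)"
          using st by (auto simp: set_facts same_type_def)
        then show ?thesis using T by blast
      qed
    qed
  qed
  \<comment> \<open>The two valuations agree on the variables 0 and 1 only; elsewhere
    \<open>lookup\<close> yields 0 and not \<open>y\<close>, so the bound on the variables of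
    \<open>\<phi>\<close> enters here.\<close>
  have edges: "interp_edge R \<phi> x y \<longleftrightarrow> holds R (lookup [x, y]) \<phi>" for R x y
    unfolding interp_edge_def
    by (rule holds_cong_vars) (use \<phi> in \<open>auto simp: lookup_def\<close>)
  have cert: "certificate L Ax \<phi> (parts k) l m (\<lambda>i xs. (i, xs) \<in> T) \<longleftrightarrow>
    (\<forall>\<sigma>\<in>set (List.n_lists m [0..<?N]). \<forall>ax\<in>set Ax. holds (\<lambda>i xs. (i, xs) \<in> T) (lookup \<sigma>) ax) \<and>
    (\<forall>p\<in>set (facts L ?N). \<forall>q\<in>set (facts L ?N). fst p = fst q \<longrightarrow>
      same_type_check l (snd p) (snd q) \<longrightarrow> (p \<in> T) = (q \<in> T)) \<and>
    (\<forall>x\<in>set [0..<?N]. \<forall>y\<in>set [0..<?N]. x mod k \<noteq> y mod k \<longrightarrow>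
      holds (\<lambda>i xs. (i, xs) \<in> T) (lookup [x, y]) \<phi>)" if "T \<subseteq> set (facts L ?N)" for T
    unfolding certificate_def model[OF that] hom[OF that] edges parts_def
    by (simp add: Ball_def)
  have sub: "set ` set (subseqs (facts L ?N)) = Pow (set (facts L ?N))" by (rule subseqs_powset)
  show ?thesis
  proof
    assume "certificate_check k l m L Ax \<phi>"
    then obtain rel where rel: "rel \<in> set (subseqs (facts L ?N))"
      and c: "(\<forall>\<sigma>\<in>set (List.n_lists m [0..<?N]). \<forall>ax\<in>set Ax. holds (\<lambda>i xs. (i, xs) \<in> set rel) (lookup \<sigma>) ax) \<and>
        (\<forall>p\<in>set (facts L ?N). \<forall>q\<in>set (facts L ?N). fst p = fst q \<longrightarrow>
          same_type_check l (snd p) (snd q) \<longrightarrow> (p \<in> set rel) = (q \<in> set rel)) \<and>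
        (\<forall>x\<in>set [0..<?N]. \<forall>y\<in>set [0..<?N]. x mod k \<noteq> y mod k \<longrightarrow>
          holds (\<lambda>i xs. (i, xs) \<in> set rel) (lookup [x, y]) \<phi>)"
      unfolding certificate_check_def by (elim bexE)
    from rel sub have "set rel \<subseteq> set (facts L ?N)" by blast
    from c[folded cert[OF this]] show "\<exists>R. certificate L Ax \<phi> (parts k) l m R"
      by (rule exI[of _ "\<lambda>i xs. (i, xs) \<in> set rel"])
  next
    assume "\<exists>R. certificate L Ax \<phi> (parts k) l m R"
    then obtain R where R: "certificate L Ax \<phi> (parts k) l m R" ..
    define T where "T = {(i, xs). R i xs}"
    have "is_struct L ?N R" using R by (simp add: certificate_def is_model_def)
    then have T: "T \<subseteq> set (facts L ?N)" by (auto simp: T_def is_struct_def set_facts)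
    then obtain rel where rel: "rel \<in> set (subseqs (facts L ?N))" "set rel = T"
      using sub by (metis PowI imageE)
    have "certificate L Ax \<phi> (parts k) l m (\<lambda>i xs. (i, xs) \<in> T)" using R by (simp add: T_def)
    from this[unfolded cert[OF T]] rel show "certificate_check k l m L Ax \<phi>"
      unfolding certificate_check_def by (intro bexI[of _ rel]) (simp_all only:)
  qed
qed

lemma computable_facts:
  assumes "computable L" "computable N"
  shows "computable (\<lambda>e. facts (L e) (N e))"
  unfolding facts_def
  by (intro computable_intros assms computable_compose[OF assms(1)] computable_compose[OF assms(2)])

lemma computable_same_type_check:
  assumes "computable l" "computable xs" "computable ys"
  shows "computable (\<lambda>e. same_type_check (l e) (xs e) (ys e))"
  unfolding same_type_check_def
  by (intro computable_intros computable_lookup assms computable_compose[OF assms(1)]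
      computable_compose[OF assms(2)] computable_compose[OF assms(3)])

lemma computable_certificate_check:
  "computable (\<lambda>e. certificate_check (fst e) (fst (snd e)) (fst (snd (snd e))) (fst (snd (snd (snd e))))
    (fst (snd (snd (snd (snd e))))) (snd (snd (snd (snd (snd e))))))"
  unfolding certificate_check_def
  by (intro computable_intros computable_holds computable_facts computable_same_type_check)

section \<open>Bounding variables and arities by the code of the input\<close>

lemma le_list_encode: "x \<in> set xs \<Longrightarrow> x \<le> list_encode xs"
proof (induction xs)
  case (Cons y ys)
  then show ?case
    using le_prod_encode_1[of y "list_encode ys"] le_prod_encode_2[of "list_encode ys" y] by auto
qed simp

lemma qf_vars_le_enc_qf: "v \<in> qf_vars q \<Longrightarrow> v \<le> enc_qf q"
proof (induction q)
  case (Atom i vs)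
  then have "v \<le> list_encode vs" by (simp add: le_list_encode)
  also have "\<dots> \<le> enc_qf (Atom i vs)"
    by (simp, rule order_trans[OF le_prod_encode_2 le_prod_encode_2])
  finally show ?case .
next
  case (Eq a b)
  then have "v \<le> prod_encode (a, b)" using le_prod_encode_1[of a b] le_prod_encode_2[of b a] by auto
  also have "\<dots> \<le> enc_qf (Eq a b)" by (simp add: le_prod_encode_2)
  finally show ?case .
next
  case (Neg p)
  then have "v \<le> enc_qf p" by simp
  also have "\<dots> \<le> enc_qf (Neg p)" by (simp add: le_prod_encode_2)
  finally show ?case .
next
  case (Conj p q)
  then have "v \<le> prod_encode (enc_qf p, enc_qf q)"
    using le_prod_encode_1[of "enc_qf p" "enc_qf q"] le_prod_encode_2[of "enc_qf q" "enc_qf p"] by force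
  also have "\<dots> \<le> enc_qf (Conj p q)" by (simp add: le_prod_encode_2)
  finally show ?case .
next
  case (Disj p q)
  then have "v \<le> prod_encode (enc_qf p, enc_qf q)"
    using le_prod_encode_1[of "enc_qf p" "enc_qf q"] le_prod_encode_2[of "enc_qf q" "enc_qf p"] by force
  also have "\<dots> \<le> enc_qf (Disj p q)" by (simp add: le_prod_encode_2)
  finally show ?case .
qed simp

lemma qf_vars_le_enc_input:
  assumes "ax \<in> set Ax" "v \<in> qf_vars ax"
  shows "v \<le> enc_input L Ax \<phi> t"
proof -
  have "v \<le> enc_qf ax" by (rule qf_vars_le_enc_qf[OF assms(2)])
  also have "\<dots> \<le> list_encode (map enc_qf Ax)" using assms(1) by (simp add: le_list_encode)
  also have "\<dots> \<le> enc_input L Ax \<phi> t"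
    unfolding enc_input_def by (rule order_trans[OF le_prod_encode_1 le_prod_encode_2])
  finally show ?thesis .
qed

lemma arity_le_enc_input: "i < length L \<Longrightarrow> L ! i \<le> enc_input L Ax \<phi> t"
  unfolding enc_input_def by (rule order_trans[OF le_list_encode le_prod_encode_1]) simp

text \<open>The code of the input bounds all its variables and arities.\<close>

definition realizable_check :: "nat \<Rightarrow> nat list \<times> qf list \<times> qf \<times> nat \<Rightarrow> bool" where
  "realizable_check k x = certificate_check k (if k = 0 then 1 else k) (Suc (Suc (enc x)))
    (fst x) (fst (snd x)) (fst (snd (snd x)))"

lemma realizable_check_iff:
  assumes "qf_vars \<phi> \<subseteq> {0, 1}"
  shows "realizable_check k (L, Ax, \<phi>, t) \<longleftrightarrow> realizable L Ax \<phi> (parts k)"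
proof -
  \<comment> \<open>One successor makes the bound on the variables strict, the other guarantees
    \<open>2 \<le> ?m\<close>.\<close>
  let ?m = "Suc (Suc (enc_input L Ax \<phi> t))" and ?l = "if k = 0 then 1 else k"
  have vars: "qf_vars ax \<subseteq> {..<?m}" if "ax \<in> set Ax" for ax
  proof
    fix v assume "v \<in> qf_vars ax"
    with that have "v \<le> enc_input L Ax \<phi> t" by (rule qf_vars_le_enc_input)
    then show "v \<in> {..<?m}" by simp
  qed
  have arity: "L ! i \<le> ?m" if "i < length L" for i
    using arity_le_enc_input[OF that] by (meson le_SucI)
  have l: "0 < ?l" by simp
  have "realizable_check k (L, Ax, \<phi>, t) \<longleftrightarrow> certificate_check k ?l ?m L Ax \<phi>"
    by (simp only: realizable_check_def fst_conv snd_conv enc_input_eq)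
  also have "\<dots> \<longleftrightarrow> (\<exists>R. certificate L Ax \<phi> (parts k) ?l ?m R)"
    by (rule certificate_check_iff[OF vars assms l]) simp_all
  also have "\<dots> \<longleftrightarrow> realizable L Ax \<phi> (parts k)"
  proof
    assume "\<exists>R. certificate L Ax \<phi> (parts k) ?l ?m R"
    then obtain R where "certificate L Ax \<phi> (parts k) ?l ?m R" ..
    then show "realizable L Ax \<phi> (parts k)"
      by (rule certificate_imp_realizable[OF _ l _ vars parts_same_type]) simp
  next
    assume "realizable L Ax \<phi> (parts k)"
    then show "\<exists>R. certificate L Ax \<phi> (parts k) ?l ?m R"
      by (rule realizable_imp_certificate[OF _ l arity parts_same_type])
  qed
  finally show ?thesis .
qed

lemma computable_realizable_check:
  assumes "computable k" "computable x"
  shows "computable (\<lambda>e. realizable_check (k e) (x e))"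
  unfolding realizable_check_def
  by (rule computable_compose[OF computable_certificate_check, of "\<lambda>e. (k e, if k e = 0 then 1 else k e,
        Suc (Suc (enc (x e))), fst (x e), fst (snd (x e)), fst (snd (snd (x e))))", unfolded fst_conv snd_conv])
     (intro computable_basic computable_enc assms)

text \<open>Follows the format of \<open>decode_out\<close>. The first entry is 0 for infinity and
  otherwise one more than \<open>chi\<close>, which is \<open>Suc n\<close>. The flag 0 means minus
  infinity. A fraction is stored with its denominator decreased by one, hence
  \<open>n ^ t - 1\<close>, with the power written as a product.\<close>

definition answer :: "nat \<Rightarrow> nat list \<times> qf list \<times> qf \<times> nat \<Rightarrow> nat" where
  "answer n x = (if realizable_check 0 x then prod_encode (0, prod_encode (1, prod_encode (1, 0)))
    else prod_encode (Suc (Suc n), prod_encode (if n = 0 then 0 else 1,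
      prod_encode (\<Prod>j<snd (snd (snd x)). n - j, (\<Prod>j<snd (snd (snd x)). n) - 1))))"

lemma computable_answer: "computable (\<lambda>p. answer (fst p) (snd p))"
  unfolding answer_def by (intro computable_intros computable_realizable_check)

lemma decode_answer_infinite:
  assumes "qf_vars \<phi> \<subseteq> {0, 1}" "realizable L Ax \<phi> (parts 0)"
  shows "fst (decode_out (answer n (L, Ax, \<phi>, t))) = chi L Ax \<phi>"
    and "pi_seq L Ax \<phi> t \<longlonglongrightarrow> snd (decode_out (answer n (L, Ax, \<phi>, t)))"
  using chi_infinite[OF assms(2)] pi_seq_complete[OF assms(2), of t] assms
  by (simp_all add: answer_def decode_out_def realizable_check_iff one_ereal_def)

lemma decode_answer_finite:
  assumes \<phi>: "qf_vars \<phi> \<subseteq> {0, 1}" and inf: "\<not> realizable L Ax \<phi> (parts 0)"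
    and n: "\<not> realizable L Ax \<phi> (parts (Suc n))" "0 < n \<Longrightarrow> realizable L Ax \<phi> (parts n)"
  shows "fst (decode_out (answer n (L, Ax, \<phi>, t))) = chi L Ax \<phi>"
    and "pi_seq L Ax \<phi> t \<longlonglongrightarrow> snd (decode_out (answer n (L, Ax, \<phi>, t)))"
proof -
  show "fst (decode_out (answer n (L, Ax, \<phi>, t))) = chi L Ax \<phi>"
    using chi_finite[OF n] \<phi> inf by (simp add: answer_def decode_out_def realizable_check_iff)
  show "pi_seq L Ax \<phi> t \<longlonglongrightarrow> snd (decode_out (answer n (L, Ax, \<phi>, t)))"
  proof (cases "n = 0")
    case True
    then show ?thesis
      using pi_seq_no_models[of L Ax \<phi> t] n(1) \<phi> inf
      by (simp add: answer_def decode_out_def realizable_check_iff)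
  next
    case False
    have "Suc ((\<Prod>j<t. n) - 1) = n ^ t" using False by simp
    then have "snd (decode_out (answer n (L, Ax, \<phi>, t))) = ereal (real (\<Prod>j<t. n - j) / real (n ^ t))"
      using False \<phi> inf by (simp add: answer_def decode_out_def realizable_check_iff del: of_nat_prod)
    also have "\<dots> = ereal (\<Prod>j<t. 1 - real j / real n)"
      using False by (simp add: prod_one_minus del: of_nat_prod)
    finally show ?thesis using pi_seq_limit[OF _ n(2,1), of t] False by simp
  qed
qed

theorem theorem3p4:
  shows "\<exists>prog. \<forall>L Ax \<phi> t.
    (\<forall>ax\<in>set Ax. qf_wf L ax) \<and> canonical_theory L Ax \<and> is_open_interp L Ax \<phi> \<longrightarrow>
    (\<exists>c. rec_eval prog [enc_input L Ax \<phi> t] c \<and>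
         fst (decode_out c) = chi L Ax \<phi> \<and>
         (pi_seq L Ax \<phi> t \<longlonglongrightarrow> snd (decode_out c)))"
proof -
  \<comment> \<open>The first disjunct lets the unbounded search for \<open>n\<close> stop when \<open>chi\<close> is infinite.\<close>
  define found where "found n x \<longleftrightarrow> realizable_check 0 x \<or> \<not> realizable_check (Suc n) x" for n x
  have "computable (\<lambda>p. if found (fst p) (snd p) then 0 else 1 :: nat)"
    unfolding found_def by (intro computable_basic computable_realizable_check)
  then obtain p where p: "\<And>x. rec_eval p [enc x] (enc (if found (fst x) (snd x) then 0 else 1 :: nat))"
    unfolding computable_def by blast
  from computable_answer obtain q where q: "\<And>x. rec_eval q [enc x] (enc (answer (fst x) (snd x)))"
    unfolding computable_def by blast
  have step: "rec_eval (Cn p [r_pair]) [n, enc x] (if found n x then 0 else 1)" for n x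
    using p[of "(n, x)"] rec_eval_pair[of n "enc x"]
    by (auto simp: enc_pair enc_nat_def intro: rec_eval_Cn1)
  \<comment> \<open>Minimization finds \<open>n\<close>; the code of \<open>n\<close> paired with
    the input is then passed to the program for \<open>answer\<close>.\<close>
  let ?prog = "Cn q [Cn r_pair [Mn (Cn p [r_pair]), Id 0]]"
  show ?thesis
  proof (intro exI[of _ ?prog] allI impI)
    fix L Ax \<phi> and t :: nat
    assume "(\<forall>ax\<in>set Ax. qf_wf L ax) \<and> canonical_theory L Ax \<and> is_open_interp L Ax \<phi>"
    then have \<phi>: "qf_vars \<phi> \<subseteq> {0, 1}" by (simp add: is_open_interp_def)
    let ?x = "(L, Ax, \<phi>, t)"
    have found: "found n ?x \<longleftrightarrow> realizable L Ax \<phi> (parts 0) \<or> \<not> realizable L Ax \<phi> (parts (Suc n))" for n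
      by (simp add: found_def realizable_check_iff[OF \<phi>])
    \<comment> \<open>If complete graphs are not realizable, some number of parts fails, so the
      search halts in either case.\<close>
    have ex: "\<exists>n. found n ?x"
      unfolding found using realizable_complete_iff by blast
    define n where "n = (LEAST n. found n ?x)"
    have n: "found n ?x" unfolding n_def using ex by (rule LeastI_ex)
    have less: "\<not> found k ?x" if "k < n" for k using that unfolding n_def by (rule not_less_Least)
    have "rec_eval (Mn (Cn p [r_pair])) [enc ?x] n"
    proof (rule rec_eval.rmn)
      show "rec_eval (Cn p [r_pair]) [n, enc ?x] 0" using step[of n ?x] n by simp
      show "\<forall>k<n. \<exists>y. 0 < y \<and> rec_eval (Cn p [r_pair]) [k, enc ?x] y"
      proof (intro allI impI)
        fix k assume "k < n"
        then show "\<exists>y. 0 < y \<and> rec_eval (Cn p [r_pair]) [k, enc ?x] y"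
          using step[of k ?x] less[of k] by (intro exI[of _ 1]) simp
      qed
    qed
    then have "rec_eval (Cn r_pair [Mn (Cn p [r_pair]), Id 0]) [enc ?x] (enc (n, ?x))"
      unfolding enc_pair[of n] enc_nat_def by (rule rec_eval_Cn2[OF _ rec_eval_Id0 rec_eval_pair])
    then have "rec_eval ?prog [enc ?x] (enc (answer n ?x))"
      using q[of "(n, ?x)"] by (intro rec_eval_Cn1) simp_all
    then have eval: "rec_eval ?prog [enc_input L Ax \<phi> t] (answer n ?x)"
      by (simp add: enc_input_eq enc_nat_def)
    have "fst (decode_out (answer n ?x)) = chi L Ax \<phi> \<and>
      (pi_seq L Ax \<phi> t \<longlonglongrightarrow> snd (decode_out (answer n ?x)))"
    proof (cases "realizable L Ax \<phi> (parts 0)")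
      case True
      then show ?thesis using decode_answer_infinite[OF \<phi>] by blast
    next
      case False
      have "\<not> realizable L Ax \<phi> (parts (Suc n))" using n False by (simp add: found)
      \<comment> \<open>Minimality at \<open>n - 1\<close> says that \<open>n\<close> parts are
        realizable. For \<open>n = 0\<close> nothing is claimed, in accordance with the hypothesis
        of \<open>decode_answer_finite\<close>.\<close>
      moreover have "realizable L Ax \<phi> (parts n)" if "0 < n"
        using less[of "n - 1"] that by (simp add: found)
      ultimately show ?thesis using decode_answer_finite[OF \<phi> False] by blast
    qed
    with eval show "\<exists>c. rec_eval ?prog [enc_input L Ax \<phi> t] c \<and> fst (decode_out c) = chi L Ax \<phi> \<and>
      (pi_seq L Ax \<phi> t \<longlonglongrightarrow> snd (decode_out c))" by blast
  qed
qed

end
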